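(* Let $f,g:\mathbb{R}\to\mathbb{R}$ satisfy: $f,g\in C^\infty(\mathbb{R})$; $f(0)=0$ and $f''(x)\ge 0$ for all $x\in\mathbb{R}$; $g(x)\ge 0$ for all $x\in\mathbb{R}$, and $g(x)=0$ if and only if $x=0$. Suppose in addition $f'(0)=0$. Let $T>0$, $s>3/2$, and let $u\in C^0([0,T];H^s(\mathbb{R}))$ be a non-trivial (not identically vanishing) solution of $$u_t+f'(u)u_x+\partial_x\Lambda^{-2}\Big(g(u)+\frac{f''(u)}{2}u_x^2\Big)=0 .$$ Then $u$ cannot be spatially compactly supported at two different times; that is, there are no $t_0\neq t_1$ in $[0,T]$ such that both $u(t_0,\cdot)$ and $u(t_1,\cdot)$ have compact support in $\mathbb{R}$.
   Context: Functions are real-valued, $t$ denotes time and $x$ space. $\Lambda^{-2}=(1-\partial_x^2)^{-1}$ is the inverse Helmholtz operator: $\Lambda^{-2}h=p\ast h$ and $\partial_x\Lambda^{-2}h=(\partial_x p)\ast h$, where $p(x)=\tfrac12 e^{-|x|}$, $\partial_xp(x)=-\mathrm{sgn}(x)p(x)$ and $\ast$ is convolution in $x$. $H^s(\mathbb{R})$ is the usual Sobolev space. By local well-posedness theory such solutions also belong to $C^1([0,T];H^{s-1}(\mathbb{R}))$. *)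

theory Defs
  imports "HOL-Analysis.Analysis"
begin

definition smooth :: "(real \<Rightarrow> real) \<Rightarrow> bool" where
  "smooth f \<longleftrightarrow> (\<forall>n. (deriv ^^ n) f differentiable_on UNIV)"

definition compactly_supported :: "(real \<Rightarrow> real) \<Rightarrow> bool" where
  "compactly_supported h \<longleftrightarrow> compact (closure {x. h x \<noteq> 0})"

definition square_integrable :: "(real \<Rightarrow> 'a::{banach, second_countable_topology}) \<Rightarrow> bool" where
  "square_integrable h \<longleftrightarrow>
     h \<in> borel_measurable lborel \<and> integrable lborel (\<lambda>x. (norm (h x))\<^sup>2)"

definition truncated_fourier :: "nat \<Rightarrow> (real \<Rightarrow> real) \<Rightarrow> real \<Rightarrow> complex" where
  "truncated_fourier n h \<xi> =
     of_real (1 / sqrt (2 * pi)) *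
     (LINT x:{-real n..real n}|lborel. cis (- (\<xi> * x)) * of_real (h x))"

text \<open>The Fourier-Plancherel transform of a square integrable \<open>h\<close> is the \<open>L\<^sup>2\<close> limit of the
  Fourier integrals over \<open>[-n, n]\<close>; it is determined only up to null sets, hence a relation.  The
  distance is measured by \<open>nn_integral\<close>, which has no default value for non-integrable functions.\<close>

definition has_fourier_L2 :: "(real \<Rightarrow> real) \<Rightarrow> (real \<Rightarrow> complex) \<Rightarrow> bool" where
  "has_fourier_L2 h v \<longleftrightarrow>
     square_integrable h \<and> square_integrable v \<and>
     (\<lambda>n. \<integral>\<^sup>+ \<xi>. ennreal ((norm (truncated_fourier n h \<xi> - v \<xi>))\<^sup>2) \<partial>lborel) \<longlonglongrightarrow> 0"

text \<open>\<open>H\<^sup>s(\<real>)\<close> for \<open>s \<ge> 0\<close>, as a set of functions rather than of classes modulo null sets.\<close>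

definition sobolev :: "real \<Rightarrow> (real \<Rightarrow> real) set" where
  "sobolev s = {h. \<exists>v. has_fourier_L2 h v \<and>
     integrable lborel (\<lambda>\<xi>. (1 + \<xi>\<^sup>2) powr s * (norm (v \<xi>))\<^sup>2)}"

text \<open>The integral does not depend on the representative of the transform that is chosen.\<close>

definition sobolev_norm :: "real \<Rightarrow> (real \<Rightarrow> real) \<Rightarrow> real" where
  "sobolev_norm s h =
     sqrt (LINT \<xi>|lborel. (1 + \<xi>\<^sup>2) powr s * (norm ((SOME v. has_fourier_L2 h v) \<xi>))\<^sup>2)"

definition continuous_sobolev :: "real \<Rightarrow> real \<Rightarrow> (real \<Rightarrow> real \<Rightarrow> real) \<Rightarrow> bool" where
  "continuous_sobolev s T u \<longleftrightarrow>
     (\<forall>t\<in>{0..T}. u t \<in> sobolev s) \<and>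
     (\<forall>t\<in>{0..T}. ((\<lambda>\<tau>. sobolev_norm s (\<lambda>x. u \<tau> x - u t x)) \<longlongrightarrow> 0) (at t within {0..T}))"

definition convolve :: "(real \<Rightarrow> real) \<Rightarrow> (real \<Rightarrow> real) \<Rightarrow> real \<Rightarrow> real" where
  "convolve k h x = (LINT y|lborel. k (x - y) * h y)"

definition helmholtz_kernel :: "real \<Rightarrow> real" where
  "helmholtz_kernel x = exp (- \<bar>x\<bar>) / 2"

definition dx_helmholtz_kernel :: "real \<Rightarrow> real" where
  "dx_helmholtz_kernel x = - sgn x * helmholtz_kernel x"

text \<open>The operator \<open>\<partial>\<^sub>x (1 - \<partial>\<^sub>x\<^sup>2)\<^sup>-\<^sup>1\<close>.\<close>

definition dx_inv_helmholtz :: "(real \<Rightarrow> real) \<Rightarrow> real \<Rightarrow> real" where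
  "dx_inv_helmholtz h = convolve dx_helmholtz_kernel h"

text \<open>For \<open>s > 3/2\<close> a solution in \<open>C\<^sup>0([0,T]; H\<^sup>s)\<close> lies in \<open>C\<^sup>1([0,T]; H\<^sup>s\<^sup>-\<^sup>1)\<close>, and \<open>H\<^sup>s\<^sup>-\<^sup>1\<close> embeds into
  the bounded continuous functions; so, for the continuous representatives \<open>u t\<close>, the derivatives
  \<open>u\<^sub>t\<close> (one-sided at \<open>0\<close> and \<open>T\<close>) and \<open>u\<^sub>x\<close> exist classically and the equation holds at every
  point.  No joint regularity of \<open>u\<close> is required here.\<close>

definition solves :: "(real \<Rightarrow> real) \<Rightarrow> (real \<Rightarrow> real) \<Rightarrow> real \<Rightarrow> (real \<Rightarrow> real \<Rightarrow> real) \<Rightarrow> bool" where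
  "solves f g T u \<longleftrightarrow>
     (\<forall>t\<in>{0..T}. \<forall>x. \<exists>ut ux.
        ((\<lambda>\<tau>. u \<tau> x) has_real_derivative ut) (at t within {0..T}) \<and>
        (u t has_real_derivative ux) (at x) \<and>
        ut + deriv f (u t x) * ux
          + dx_inv_helmholtz
              (\<lambda>y. g (u t y) + deriv (deriv f) (u t y) / 2 * (deriv (u t) y)\<^sup>2) x = 0)"

end

(* Write F = g(u) + f''(u) u_x^2 / 2 >= 0 and p * F for the convolution with p, so that the equation
   reads u_t + (f(u) + p * F)_x = 0. Let u vanish on [R, oo) at the times t0 < t1. Integrating the
   equation over [t0, t1] x [a, b] with R <= a shows that H(x) = int_{t0}^{t1} (f(u) + p * F) dt is
   constant for x >= R, and H tends to 0 at infinity, so H(R) = 0. Since f is convex with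
   f(0) = f'(0) = 0, both f(u) and p * F are nonnegative; hence p * F = 0 at (t0, R), so F = 0 and
   u = 0 at time t0.

   It remains to see that a solution vanishing at one time vanishes identically. The maximum
   principle, with the weight exp(- l |t - t0|) to treat both time directions at once and a penalty in
   x in place of decay at infinity, applies to u and to its difference quotients w in x, both of which
   satisfy transport equations. The quotients replace u_x, whose equation would involve u_xx, and p * F
   costs no derivative because p'' = p - delta. A bound |u|, |u_x| <= N exp(l |t - t0|)
   is thereby improved to N / 2, if l is large.

   All this takes place in the space of bounded C^1 functions. The embedding of H^s, s > 3/2, into that
   space rests on the inversion formula for the L^2 Fourier transform, which is obtained by pairing
   the truncated transforms with Gaussians. *)

theory Submission
  imports Defs "HOL-Probability.Characteristic_Functions" "HOL-Real_Asymp.Real_Asymp"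
begin

section \<open>Fourier inversion and the Sobolev embedding\<close>

text \<open>The transform in \<open>has_fourier_L2\<close> is only an L^2 limit, so no pointwise
  formula for it is at hand. A Gaussian times a character is a test function with an explicit
  transform; it turns the defining limit into an identity between a regularised inversion integral
  and a mollification, by Fubini and Cauchy-Schwarz alone.

  A solution need not have second derivatives in x, so its derivative cannot be followed along
  characteristics by a pointwise equation. The maximum principle is therefore phrased with the
  inequality |w_t| <= K exp(l |t - t0|) + A |w_x|, which the transport term enters only through a
  bound A of its speed. The halving can be repeated because every estimate is linear in N: in the
  quadratic terms one factor is controlled by the a priori bound B, and the iteration starts from N
  = B.

  The flux argument yields p * F = 0 at a single point. Since p vanishes nowhere and F is
  nonnegative and continuous, this one zero spreads over the whole line.\<close>

lemma borel_measurable_cis [measurable]: "cis \<in> borel_measurable borel"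
proof -
  have "isCont cis x" for x
    unfolding cis_conv_exp[abs_def] by simp
  then show ?thesis
    by (intro borel_measurable_continuous_onI continuous_at_imp_continuous_on) auto
qed

text \<open>The characteristic function of the standard normal distribution, rescaled by
  \<open>1 / e\<close>. Written as a normal density, the result is visibly an approximate identity
  as \<open>e\<close> tends to 0.\<close>

lemma integral_cis_gaussian:
  assumes "e > 0"
  shows "(LINT x|lborel. cis (t * x) * of_real (exp (- (e * x)\<^sup>2 / 2))) =
    complex_of_real (2 * pi * normal_density 0 e t)"
proof -
  have 1: "(LINT x|lborel. std_normal_density x *\<^sub>R iexp (r * x)) = complex_of_real (exp (- r\<^sup>2 / 2))" for r
  proof -
    have "char std_normal_distribution r = (LINT x|lborel. std_normal_density x *\<^sub>R iexp (r * x))"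
      unfolding char_def by (subst integral_density) auto
    then show ?thesis
      by (simp add: char_std_normal_distribution)
  qed
  have eq: "cis (t * (0 + 1/e * x)) * of_real (exp (- (e * (0 + 1/e * x))\<^sup>2 / 2))
      = complex_of_real (sqrt (2 * pi)) * (std_normal_density x *\<^sub>R iexp (t / e * x))" for x
    using assms by (simp add: std_normal_density_def cis_conv_exp scaleR_conv_of_real field_simps)
  have sq: "sqrt (2 * pi) * sqrt (2 * pi) = 2 * pi"
    by simp
  have "(LINT x|lborel. cis (t * x) * of_real (exp (- (e * x)\<^sup>2 / 2)))
      = \<bar>1/e\<bar> *\<^sub>R (LINT x|lborel. complex_of_real (sqrt (2 * pi)) * (std_normal_density x *\<^sub>R iexp (t / e * x)))"
    unfolding eq[symmetric] using assms by (intro lborel_integral_real_affine) simp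
  also have "\<dots> = complex_of_real (sqrt (2 * pi) / e * exp (- (t/e)\<^sup>2 / 2))"
    unfolding integral_mult_right_zero 1 using assms by (simp add: scaleR_conv_of_real)
  also have "sqrt (2 * pi) / e * exp (- (t/e)\<^sup>2 / 2) = 2 * pi * normal_density 0 e t"
    using assms sq unfolding normal_density_def
    by (simp add: real_sqrt_mult power_divide field_simps flip: power2_eq_square)
  finally show ?thesis .
qed

lemma integrable_gaussian [simp]:
  assumes "e > (0::real)"
  shows "integrable lborel (\<lambda>x. exp (- (e * x)\<^sup>2 / 2))"
proof -
  have "exp (- (e * x)\<^sup>2 / 2) = sqrt (2 * pi) / e * normal_density 0 (1/e) x" for x
    using assms by (simp add: normal_density_def real_sqrt_mult power_divide real_sqrt_divide field_simps)
  moreover have "integrable lborel (normal_density 0 (1/e))"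
    using assms by (intro integrable_normal_density) simp
  ultimately show ?thesis
    by simp
qed

text \<open>Fubini applies because the integrand is dominated by
  \<open>\<bar>k x\<bar> * G \<xi>\<close>; the inner integral over \<open>\<xi>\<close> is then the
  transform of the Gaussian at \<open>a - x\<close>.\<close>

lemma integral_fourier_gaussian:
  fixes k :: "real \<Rightarrow> real"
  assumes k: "integrable lborel k" and "e > 0"
  shows "(LINT \<xi>|lborel. (LINT x|lborel. cis (- (\<xi> * x)) * of_real (k x)) *
       (cis (a * \<xi>) * of_real (exp (- (e * \<xi>)\<^sup>2 / 2))))
    = complex_of_real (2 * pi * (LINT x|lborel. k x * normal_density 0 e (a - x)))"
proof -
  have [measurable]: "k \<in> borel_measurable borel"
    using k by (auto dest: borel_measurable_integrable)
  define G where "G \<xi> = exp (- (e * \<xi>)\<^sup>2 / 2)" for \<xi>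
  have [measurable]: "G \<in> borel_measurable borel"
    unfolding G_def[abs_def] by simp
  have G: "integrable lborel G" "\<And>x. G x \<ge> 0"
    using integrable_gaussian[OF \<open>e > 0\<close>] by (auto simp: G_def[abs_def])
  define f where "f x \<xi> = cis (- (\<xi> * x)) * of_real (k x) * (cis (a * \<xi>) * of_real (G \<xi>))" for x \<xi>
  have nf: "norm (f x \<xi>) = \<bar>k x\<bar> * G \<xi>" for x \<xi>
    using G(2) by (simp add: f_def norm_mult)
  have mf [measurable]: "(\<lambda>(x,\<xi>). f x \<xi>) \<in> borel_measurable (lborel \<Otimes>\<^sub>M lborel)"
    unfolding f_def by measurable
  have int: "integrable (lborel \<Otimes>\<^sub>M lborel) (\<lambda>(x,\<xi>). f x \<xi>)"
  proof (rule lborel_pair.Fubini_integrable)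
    show "integrable lborel (\<lambda>x. LINT y|lborel. norm (case (x, y) of (x, \<xi>) \<Rightarrow> f x \<xi>))"
      using k by (simp add: nf)
    show "AE x in lborel. integrable lborel (\<lambda>y. case (x, y) of (x, \<xi>) \<Rightarrow> f x \<xi>)"
    proof (rule AE_I2)
      fix x
      have "integrable lborel (\<lambda>\<xi>. \<bar>k x\<bar> * G \<xi>)"
        using G by simp
      moreover have "(\<lambda>\<xi>. f x \<xi>) \<in> borel_measurable lborel"
        unfolding f_def by measurable
      ultimately show "integrable lborel (\<lambda>y. case (x, y) of (x, \<xi>) \<Rightarrow> f x \<xi>)"
        unfolding prod.case by (rule Bochner_Integration.integrable_bound) (auto simp: nf G(2))
    qed
  qed (use mf in simp)
  have "(LINT \<xi>|lborel. (LINT x|lborel. cis (- (\<xi> * x)) * of_real (k x)) * (cis (a * \<xi>) * of_real (G \<xi>)))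
     = (LINT \<xi>|lborel. (LINT x|lborel. f x \<xi>))"
    by (simp add: f_def)
  also have "\<dots> = (LINT x|lborel. (LINT \<xi>|lborel. f x \<xi>))"
    by (rule lborel_pair.Fubini_integral[OF int])
  also have "\<dots> = (LINT x|lborel. of_real (2 * pi * (k x * normal_density 0 e (a - x))))"
  proof (rule Bochner_Integration.integral_cong)
    fix x
    have "(LINT \<xi>|lborel. f x \<xi>)
        = (LINT \<xi>|lborel. of_real (k x) * (cis ((a - x) * \<xi>) * of_real (G \<xi>)))"
      by (rule Bochner_Integration.integral_cong) (auto simp: f_def cis_mult algebra_simps)
    also have "\<dots> = of_real (k x) * complex_of_real (2 * pi * normal_density 0 e (a - x))"
      unfolding integral_mult_right_zero G_def integral_cis_gaussian[OF \<open>e > 0\<close>] ..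
    finally show "(LINT \<xi>|lborel. f x \<xi>) = of_real (2 * pi * (k x * normal_density 0 e (a - x)))"
      by simp
  qed simp
  also have "\<dots> = complex_of_real (2 * pi * (LINT x|lborel. k x * normal_density 0 e (a - x)))"
    by (simp only: integral_complex_of_real integral_mult_right_zero)
  finally show ?thesis
    by (simp add: G_def)
qed

lemma square_integrable_imp_integrable_mult:
  fixes h k :: "real \<Rightarrow> real"
  assumes "square_integrable h" "square_integrable k"
  shows "integrable lborel (\<lambda>x. h x * k x)"
proof -
  have [measurable]: "h \<in> borel_measurable borel" "k \<in> borel_measurable borel"
    using assms by (auto simp: square_integrable_def)
  have "integrable lborel (\<lambda>x. (h x)\<^sup>2 + (k x)\<^sup>2)"
    using assms by (auto simp: square_integrable_def)
  then show ?thesis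
  proof (rule Bochner_Integration.integrable_bound)
    have "\<bar>h x * k x\<bar> \<le> (h x)\<^sup>2 + (k x)\<^sup>2" for x
    proof -
      have "0 \<le> (\<bar>h x\<bar> - \<bar>k x\<bar>)\<^sup>2" "0 \<le> (h x)\<^sup>2" "0 \<le> (k x)\<^sup>2" by simp_all
      then show ?thesis
        unfolding abs_mult power2_diff power2_abs by linarith
    qed
    then show "AE x in lborel. norm (h x * k x) \<le> norm ((h x)\<^sup>2 + (k x)\<^sup>2)"
      by auto
  qed simp
qed

lemma square_integrable_gaussian:
  assumes "e > 0"
  shows "square_integrable (\<lambda>x. exp (- (e * x)\<^sup>2 / 2))"
proof -
  have "(exp (- (e * x)\<^sup>2 / 2))\<^sup>2 = exp (- (sqrt 2 * e * x)\<^sup>2 / 2)" for x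
    by (simp add: power_mult_distrib flip: exp_double)
  then show ?thesis
    using integrable_gaussian[of "sqrt 2 * e"] assms by (simp add: square_integrable_def)
qed

lemma square_integrable_normal_density:
  assumes "e > 0"
  shows "square_integrable (\<lambda>x. normal_density 0 e (a - x))"
  unfolding square_integrable_def
proof
  have "integrable lborel (\<lambda>x. normal_density 0 e (a + (-1) * x))"
    by (intro lborel_integrable_real_affine integrable_normal_density) (use assms in auto)
  then have "integrable lborel (\<lambda>x. 1 / sqrt (2 * pi * e\<^sup>2) * normal_density 0 e (a + (-1) * x))"
    by (rule integrable_mult_right)
  then show "integrable lborel (\<lambda>x. (norm (normal_density 0 e (a - x)))\<^sup>2)"
  proof (rule Bochner_Integration.integrable_bound)
    \<comment> \<open>The density is at most its peak value, so its square is at most a multiple of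
      the density itself, which is integrable.\<close>
    have *: "normal_density 0 e (a - x) \<le> 1 / sqrt (2 * pi * e\<^sup>2)" for x
    proof -
      have "exp (- (a - x)\<^sup>2 / (2 * e\<^sup>2)) \<le> 1" by simp
      then show ?thesis
        unfolding normal_density_def using mult_left_mono[of _ 1 "1 / sqrt (2 * pi * e\<^sup>2)"] by simp
    qed
    show "AE x in lborel. norm ((norm (normal_density 0 e (a - x)))\<^sup>2) \<le>
        norm (1 / sqrt (2 * pi * e\<^sup>2) * normal_density 0 e (a + (-1) * x))"
    proof (rule AE_I2)
      fix x
      have "normal_density 0 e (a - x) * normal_density 0 e (a - x)
          \<le> 1 / sqrt (2 * pi * e\<^sup>2) * normal_density 0 e (a - x)"
        by (intro mult_right_mono *) simp
      then show "norm ((norm (normal_density 0 e (a - x)))\<^sup>2) \<le>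
          norm (1 / sqrt (2 * pi * e\<^sup>2) * normal_density 0 e (a + (-1) * x))"
        by (simp add: power2_eq_square)
    qed
  qed simp
qed simp

lemma square_integrable_imp_integrable_truncation:
  fixes h :: "real \<Rightarrow> real"
  assumes "square_integrable h"
  shows "integrable lborel (\<lambda>x. indicator {a..b} x * h x)"
proof -
  have "square_integrable (indicat_real {a..b})"
  proof -
    have "(indicat_real {a..b} x)\<^sup>2 = indicat_real {a..b} x" for x
      by (auto simp: indicator_def)
    then show ?thesis
      by (cases "a \<le> b") (auto simp: square_integrable_def intro!: integrable_real_indicator)
  qed
  from square_integrable_imp_integrable_mult[OF this assms] show ?thesis .
qed

lemma truncated_fourier_eq:
  "truncated_fourier n h \<xi> = of_real (1 / sqrt (2 * pi)) *
    (LINT x|lborel. cis (- (\<xi> * x)) * of_real (indicator {-real n..real n} x * h x))"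
  unfolding truncated_fourier_def set_lebesgue_integral_def
  by (intro arg_cong2[where f="(*)"] Bochner_Integration.integral_cong) (auto simp: indicator_def)

lemma borel_measurable_truncated_fourier:
  assumes [measurable]: "h \<in> borel_measurable borel"
  shows "truncated_fourier n h \<in> borel_measurable borel"
  unfolding truncated_fourier_eq[abs_def] by measurable

lemma norm_truncated_fourier_le:
  "norm (truncated_fourier n h \<xi>) \<le> 1 / sqrt (2 * pi) * (LINT x|lborel. \<bar>indicator {-real n..real n} x * h x\<bar>)"
proof -
  have "norm (LINT x|lborel. cis (- (\<xi> * x)) * complex_of_real (indicator {-real n..real n} x * h x))
     \<le> (LINT x|lborel. norm (cis (- (\<xi> * x)) * complex_of_real (indicator {-real n..real n} x * h x)))"
    by (rule integral_norm_bound)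
  also have "\<dots> = (LINT x|lborel. \<bar>indicator {-real n..real n} x * h x\<bar>)"
    by (simp add: norm_mult del: of_real_mult)
  finally show ?thesis
    unfolding truncated_fourier_eq norm_mult norm_of_real by (simp add: divide_right_mono)
qed

lemma tendsto_zero_if_power2_le:
  fixes f :: "nat \<Rightarrow> 'a::real_normed_vector"
  assumes "\<And>n. ennreal ((norm (f n))\<^sup>2) \<le> g n" "g \<longlonglongrightarrow> 0"
  shows "f \<longlonglongrightarrow> 0"
proof -
  have "(\<lambda>n. ennreal ((norm (f n))\<^sup>2)) \<longlonglongrightarrow> ennreal 0"
    unfolding ennreal_0 by (rule tendsto_sandwich[OF _ _ tendsto_const assms(2)]) (use assms(1) in auto)
  then have "(\<lambda>n. (norm (f n))\<^sup>2) \<longlonglongrightarrow> 0"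
    by (subst (asm) tendsto_ennreal_iff) auto
  then have "(\<lambda>n. norm (f n)) \<longlonglongrightarrow> 0"
    using tendsto_real_sqrt[of "\<lambda>n. (norm (f n))\<^sup>2" 0] by simp
  then show ?thesis
    by (simp add: tendsto_norm_zero_iff)
qed

text \<open>Tested against \<open>\<phi>\<close>, which lies in L^1 and in L^2, the L^2 limit
  defining \<open>v\<close> becomes a limit of numbers. Each truncated transform is that of an
  integrable function and so obeys \<open>integral_fourier_gaussian\<close>.\<close>

lemma has_fourier_L2_gaussian:
  assumes h: "has_fourier_L2 h v" and "e > 0"
  shows "(LINT \<xi>|lborel. v \<xi> * (cis (a * \<xi>) * of_real (exp (- (e * \<xi>)\<^sup>2 / 2))))
    = complex_of_real (sqrt (2 * pi) * (LINT x|lborel. h x * normal_density 0 e (a - x)))"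
proof -
  have sh: "square_integrable h" and sv: "square_integrable v"
    and lim: "(\<lambda>n. \<integral>\<^sup>+ \<xi>. ennreal ((norm (truncated_fourier n h \<xi> - v \<xi>))\<^sup>2) \<partial>lborel) \<longlonglongrightarrow> 0"
    using h by (auto simp: has_fourier_L2_def)
  have [measurable]: "h \<in> borel_measurable borel" "v \<in> borel_measurable borel"
    using sh sv by (auto simp: square_integrable_def)
  note [measurable] = borel_measurable_truncated_fourier
  define G where "G \<xi> = exp (- (e * \<xi>)\<^sup>2 / 2)" for \<xi>
  have [measurable]: "G \<in> borel_measurable borel"
    unfolding G_def[abs_def] by simp
  have G: "integrable lborel G" "\<And>x. G x \<ge> 0" "integrable lborel (\<lambda>x. (G x)\<^sup>2)" "square_integrable G"
    using integrable_gaussian[OF \<open>e > 0\<close>] square_integrable_gaussian[OF \<open>e > 0\<close>]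
    by (auto simp: G_def[abs_def] square_integrable_def)
  define \<phi> where "\<phi> \<xi> = cis (a * \<xi>) * of_real (G \<xi>)" for \<xi>
  have [measurable]: "\<phi> \<in> borel_measurable borel"
    unfolding \<phi>_def[abs_def] by measurable
  have n\<phi>: "norm (\<phi> x) = G x" for x
    using G(2) by (simp add: \<phi>_def norm_mult)
  define c where "c = 1 / sqrt (2 * pi)"
  have int_t: "integrable lborel (\<lambda>\<xi>. truncated_fourier n h \<xi> * \<phi> \<xi>)" for n
  proof -
    have "integrable lborel (\<lambda>\<xi>. c * (LINT x|lborel. \<bar>indicator {-real n..real n} x * h x\<bar>) * G \<xi>)"
      using G(1) by simp
    then show ?thesis
    proof (rule Bochner_Integration.integrable_bound)
      have "norm (truncated_fourier n h \<xi> * \<phi> \<xi>)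
         \<le> c * (LINT x|lborel. \<bar>indicator {-real n..real n} x * h x\<bar>) * G \<xi>" for \<xi>
        unfolding norm_mult n\<phi> c_def by (intro mult_right_mono norm_truncated_fourier_le G(2))
      then show "AE \<xi> in lborel. norm (truncated_fourier n h \<xi> * \<phi> \<xi>)
         \<le> norm (c * (LINT x|lborel. \<bar>indicator {-real n..real n} x * h x\<bar>) * G \<xi>)"
        by (intro AE_I2) (metis order_trans real_norm_def abs_ge_self)
    qed simp
  qed
  have int_v: "integrable lborel (\<lambda>\<xi>. v \<xi> * \<phi> \<xi>)"
  proof -
    have "square_integrable (\<lambda>x. norm (v x))"
      using sv by (simp add: square_integrable_def)
    from square_integrable_imp_integrable_mult[OF this G(4)] show ?thesis
      by (rule Bochner_Integration.integrable_bound) (auto simp: norm_mult n\<phi> abs_mult G(2))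
  qed
  \<comment> \<open>Cauchy-Schwarz, in \<open>ennreal\<close> because the distance in
    \<open>has_fourier_L2\<close> is measured there: the squared difference is at most the squared
    L^2 distance times \<open>K\<close>, the squared L^2 norm of the Gaussian.\<close>
  have "(\<lambda>n. (LINT \<xi>|lborel. truncated_fourier n h \<xi> * \<phi> \<xi>) - (LINT \<xi>|lborel. v \<xi> * \<phi> \<xi>)) \<longlonglongrightarrow> 0"
  proof (rule tendsto_zero_if_power2_le)
    define K where "K = (\<integral>\<^sup>+\<xi>. (ennreal (G \<xi>))\<^sup>2 \<partial>lborel)"
    have "K = (\<integral>\<^sup>+\<xi>. ennreal ((G \<xi>)\<^sup>2) \<partial>lborel)"
      unfolding K_def using G(2) by (simp add: ennreal_power)
    also have "\<dots> < \<infinity>"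
      using G(3) by (simp add: integrable_iff_bounded)
    finally have K: "K < \<infinity>" .
    have "((\<lambda>n. K * (\<integral>\<^sup>+ \<xi>. ennreal ((norm (truncated_fourier n h \<xi> - v \<xi>))\<^sup>2) \<partial>lborel)) \<longlonglongrightarrow> K * 0)"
      by (intro tendsto_mult_ennreal tendsto_const lim) (use K in auto)
    then show "(\<lambda>n. (\<integral>\<^sup>+ \<xi>. ennreal ((norm (truncated_fourier n h \<xi> - v \<xi>))\<^sup>2) \<partial>lborel) * K) \<longlonglongrightarrow> 0"
      by (simp add: mult.commute)
    fix n
    define d where "d \<xi> = truncated_fourier n h \<xi> - v \<xi>" for \<xi>
    have [measurable]: "d \<in> borel_measurable borel"
      unfolding d_def[abs_def] by measurable
    have eq: "(LINT \<xi>|lborel. truncated_fourier n h \<xi> * \<phi> \<xi>) - (LINT \<xi>|lborel. v \<xi> * \<phi> \<xi>)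
        = (LINT \<xi>|lborel. d \<xi> * \<phi> \<xi>)"
      by (subst Bochner_Integration.integral_diff[symmetric, OF int_t int_v])
        (simp add: d_def algebra_simps)
    have int_d: "integrable lborel (\<lambda>\<xi>. d \<xi> * \<phi> \<xi>)"
      using Bochner_Integration.integrable_diff[OF int_t[of n] int_v] by (simp add: d_def algebra_simps)
    have "ennreal (norm (LINT \<xi>|lborel. d \<xi> * \<phi> \<xi>)) \<le> (\<integral>\<^sup>+\<xi>. norm (d \<xi> * \<phi> \<xi>) \<partial>lborel)"
      by (rule integral_norm_bound_ennreal[OF int_d])
    also have "\<dots> = (\<integral>\<^sup>+\<xi>. ennreal (norm (d \<xi>)) * ennreal (G \<xi>) \<partial>lborel)"
      by (simp add: norm_mult n\<phi> ennreal_mult G(2))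
    finally have "(ennreal (norm (LINT \<xi>|lborel. d \<xi> * \<phi> \<xi>)))\<^sup>2
        \<le> (\<integral>\<^sup>+\<xi>. ennreal (norm (d \<xi>)) * ennreal (G \<xi>) \<partial>lborel)\<^sup>2"
      by (rule power_mono) simp
    also have "\<dots> \<le> (\<integral>\<^sup>+\<xi>. (ennreal (norm (d \<xi>)))\<^sup>2 \<partial>lborel) * K"
      unfolding K_def by (rule Cauchy_Schwarz_nn_integral) simp_all
    finally show "ennreal ((norm ((LINT \<xi>|lborel. truncated_fourier n h \<xi> * \<phi> \<xi>) - (LINT \<xi>|lborel. v \<xi> * \<phi> \<xi>)))\<^sup>2)
       \<le> (\<integral>\<^sup>+ \<xi>. ennreal ((norm (truncated_fourier n h \<xi> - v \<xi>))\<^sup>2) \<partial>lborel) * K"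
      unfolding eq by (simp add: ennreal_power d_def)
  qed
  then have lim1: "(\<lambda>n. (LINT \<xi>|lborel. truncated_fourier n h \<xi> * \<phi> \<xi>)) \<longlonglongrightarrow> (LINT \<xi>|lborel. v \<xi> * \<phi> \<xi>)"
    by (simp add: LIM_zero_iff)
  have eq2: "(LINT \<xi>|lborel. truncated_fourier n h \<xi> * \<phi> \<xi>)
     = complex_of_real (sqrt (2 * pi) * (LINT x|lborel. indicator {-real n..real n} x * h x * normal_density 0 e (a - x)))" for n
  proof -
    have "(LINT \<xi>|lborel. truncated_fourier n h \<xi> * \<phi> \<xi>) = of_real c * (LINT \<xi>|lborel.
       (LINT x|lborel. cis (- (\<xi> * x)) * of_real (indicator {-real n..real n} x * h x)) * \<phi> \<xi>)"
      unfolding truncated_fourier_eq c_def mult.assoc by (rule integral_mult_right_zero)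
    also have "\<dots> = of_real c * complex_of_real (2 * pi * (LINT x|lborel. indicator {-real n..real n} x * h x * normal_density 0 e (a - x)))"
      unfolding \<phi>_def G_def
      by (subst integral_fourier_gaussian[OF square_integrable_imp_integrable_truncation[OF sh] \<open>e > 0\<close>]) simp
    also have "\<dots> = complex_of_real (c * (2 * pi) * (LINT x|lborel. indicator {-real n..real n} x * h x * normal_density 0 e (a - x)))"
      by simp
    also have "c * (2 * pi) = sqrt (2 * pi)"
      unfolding c_def by (simp add: real_div_sqrt)
    finally show ?thesis .
  qed
  have lim2: "(\<lambda>n. (LINT x|lborel. indicator {-real n..real n} x * h x * normal_density 0 e (a - x)))
      \<longlonglongrightarrow> (LINT x|lborel. h x * normal_density 0 e (a - x))"
  proof (rule integral_dominated_convergence)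
    show "integrable lborel (\<lambda>x. \<bar>h x * normal_density 0 e (a - x)\<bar>)"
      using square_integrable_imp_integrable_mult[OF sh square_integrable_normal_density[OF \<open>e > 0\<close>]]
      by (rule integrable_abs)
    show "AE x in lborel. (\<lambda>n. indicator {-real n..real n} x * h x * normal_density 0 e (a - x))
        \<longlonglongrightarrow> h x * normal_density 0 e (a - x)"
    proof (rule AE_I2)
      fix x :: real
      have "eventually (\<lambda>n. indicator {-real n..real n} x * h x * normal_density 0 e (a - x)
          = h x * normal_density 0 e (a - x)) sequentially"
        using eventually_ge_at_top[of "nat \<lceil>\<bar>x\<bar>\<rceil>"]
        by eventually_elim (auto simp: indicator_def)
      then show "(\<lambda>n. indicator {-real n..real n} x * h x * normal_density 0 e (a - x))
        \<longlonglongrightarrow> h x * normal_density 0 e (a - x)"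
        by (rule tendsto_eventually)
    qed
    show "AE x in lborel. norm (indicator {-real n..real n} x * h x * normal_density 0 e (a - x))
       \<le> \<bar>h x * normal_density 0 e (a - x)\<bar>" for n
      by (auto simp: indicator_def)
  qed simp_all
  have "(LINT \<xi>|lborel. v \<xi> * \<phi> \<xi>)
    = complex_of_real (sqrt (2 * pi) * (LINT x|lborel. h x * normal_density 0 e (a - x)))"
    by (rule LIMSEQ_unique[OF lim1]) (unfold eq2, intro tendsto_intros lim2)
  then show ?thesis
    by (simp add: \<phi>_def G_def)
qed

text \<open>The factor \<open>n exp (-n\<^sup>2/4)\<close> tends to \<open>0\<close> and the remaining weight is square integrable: mollifying a
  square integrable function needs no bound on it away from the point of evaluation.\<close>

lemma normal_density_tail:
  assumes "n \<ge> 1" "\<bar>x\<bar> \<ge> 1"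
  shows "normal_density 0 (1 / n) x \<le> n * exp (- n\<^sup>2 / 4) * exp (- x\<^sup>2 / 4)"
proof -
  have "n\<^sup>2 * x\<^sup>2 \<ge> n\<^sup>2 * 1" "n\<^sup>2 * x\<^sup>2 \<ge> 1 * x\<^sup>2"
    using one_le_power[OF assms(1), of 2] one_le_power[OF assms(2), of 2]
      mult_right_mono[of 1 "n\<^sup>2" "x\<^sup>2"] mult_left_mono[of 1 "x\<^sup>2" "n\<^sup>2"] by auto
  \<comment> \<open>The mean of the two lower bounds for \<open>n\<^sup>2 * x\<^sup>2\<close>,
    halved.\<close>
  then have *: "- (n\<^sup>2 * x\<^sup>2) / 2 \<le> - n\<^sup>2 / 4 + - x\<^sup>2 / 4"
    by (simp add: field_simps)
  have "normal_density 0 (1 / n) x = 1 / sqrt (2 * pi) * n * exp (- (n\<^sup>2 * x\<^sup>2) / 2)"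
  proof -
    have "- (x - 0)\<^sup>2 / (2 * (1 / n)\<^sup>2) = - (n\<^sup>2 * x\<^sup>2) / 2" "sqrt (2 * pi * (1 / n)\<^sup>2) = sqrt (2 * pi) / n"
      using assms(1) by (simp_all add: power_divide real_sqrt_mult real_sqrt_divide)
    then show ?thesis
      unfolding normal_density_def by simp
  qed
  also have "\<dots> \<le> 1 * n * exp (- n\<^sup>2 / 4 + - x\<^sup>2 / 4)"
    using * assms(1) pi_ge_two by (intro mult_mono) (simp_all add: divide_le_eq)
  finally show ?thesis
    by (simp only: exp_add mult.assoc mult_1_left)
qed

lemma LIMSEQ_one_over_Suc: "(\<lambda>n. 1 / real (Suc n)) \<longlonglongrightarrow> 0"
  using LIMSEQ_inverse_real_of_nat by (simp add: inverse_eq_divide)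

text \<open>Within distance 1 of \<open>a\<close> the function is bounded, and the substitution
  \<open>x = a + y / (n + 1)\<close> leaves a fixed density for dominated convergence. Farther away
  \<open>h\<close> is only square integrable, and \<open>normal_density_tail\<close> supplies the
  decay.\<close>

lemma normal_density_mollifier:
  assumes sh: "square_integrable h" and ch: "continuous_on UNIV h"
  shows "(\<lambda>n. LINT x|lborel. h x * normal_density 0 (1 / real (Suc n)) (a - x)) \<longlonglongrightarrow> h a"
proof -
  have [measurable]: "h \<in> borel_measurable borel"
    using sh by (auto simp: square_integrable_def)
  define h1 where "h1 x = indicator {a-1..a+1} x * h x" for x
  define h2 where "h2 x = (1 - indicator {a-1..a+1} x) * h x" for x
  have [measurable]: "h1 \<in> borel_measurable borel" "h2 \<in> borel_measurable borel"
    unfolding h1_def[abs_def] h2_def[abs_def] by measurable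
  have int: "integrable lborel (\<lambda>x. h x * normal_density 0 e (a - x))" if "e > 0" for e
    using square_integrable_imp_integrable_mult[OF sh square_integrable_normal_density[OF that]] .
  have int1: "integrable lborel (\<lambda>x. h1 x * normal_density 0 e (a - x))"
    and int2: "integrable lborel (\<lambda>x. h2 x * normal_density 0 e (a - x))" if "e > 0" for e
    by (rule Bochner_Integration.integrable_bound[OF int[OF that]];
      auto simp: h1_def h2_def indicator_def abs_mult)+
  obtain B where B: "\<And>x. \<bar>h1 x\<bar> \<le> B" "B \<ge> 0"
  proof -
    have "compact (h ` {a-1..a+1})"
      using ch by (intro compact_continuous_image continuous_on_subset[OF ch]) auto
    then obtain B where "\<forall>y\<in>h ` {a-1..a+1}. norm y \<le> B"
      using compact_imp_bounded bounded_iff by metis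
    then have "\<bar>h1 x\<bar> \<le> max 0 B" for x
      by (auto simp: h1_def indicator_def le_max_iff_disj)
    then show ?thesis
      using that[of "max 0 B"] by simp
  qed
  have lim1: "(\<lambda>n. LINT x|lborel. h1 x * normal_density 0 (1 / real (Suc n)) (a - x)) \<longlonglongrightarrow> h a"
  proof -
    have eq: "(LINT x|lborel. h1 x * normal_density 0 (1 / real (Suc n)) (a - x))
       = (LINT y|lborel. h1 (a + 1 / real (Suc n) * y) * std_normal_density y)" for n
    proof -
      have *: "normal_density 0 (1 / real (Suc n)) (a - (a + 1 / real (Suc n) * y)) = real (Suc n) * std_normal_density y" for y
      proof -
        have "- (a - (a + 1 / real (Suc n) * y) - 0)\<^sup>2 / (2 * (1 / real (Suc n))\<^sup>2) = - y\<^sup>2 / 2"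
          by (simp add: power_mult_distrib power_divide del: of_nat_Suc)
        moreover have "sqrt (2 * pi * (1 / real (Suc n))\<^sup>2) = sqrt (2 * pi) / real (Suc n)"
          by (simp add: power_divide real_sqrt_mult real_sqrt_divide del: of_nat_Suc)
        ultimately show ?thesis
          unfolding normal_density_def by simp
      qed
      have "(LINT x|lborel. h1 x * normal_density 0 (1 / real (Suc n)) (a - x))
       = \<bar>1 / real (Suc n)\<bar> *\<^sub>R (LINT y|lborel. h1 (a + 1 / real (Suc n) * y) *
           normal_density 0 (1 / real (Suc n)) (a - (a + 1 / real (Suc n) * y)))"
        by (rule lborel_integral_real_affine) simp
      also have "\<dots> = 1 / real (Suc n) * (LINT y|lborel. real (Suc n) * (h1 (a + 1 / real (Suc n) * y) * std_normal_density y))"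
        unfolding * by (simp add: mult_ac del: of_nat_Suc)
      also have "\<dots> = (LINT y|lborel. h1 (a + 1 / real (Suc n) * y) * std_normal_density y)"
        unfolding integral_mult_right_zero by (simp del: of_nat_Suc)
      finally show ?thesis .
    qed
    have "(\<lambda>n. LINT y|lborel. h1 (a + 1 / real (Suc n) * y) * std_normal_density y)
        \<longlonglongrightarrow> (LINT y|lborel. h a * std_normal_density y)"
    proof (rule integral_dominated_convergence)
      show "integrable lborel (\<lambda>y. B * std_normal_density y)"
        by simp
      show "AE y in lborel. (\<lambda>n. h1 (a + 1 / real (Suc n) * y) * std_normal_density y) \<longlonglongrightarrow> h a * std_normal_density y"
      proof (intro AE_I2 tendsto_intros)
        fix y :: real
        have "(\<lambda>n. a + 1 / real (Suc n) * y) \<longlonglongrightarrow> a + 0 * y"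
          by (intro tendsto_intros LIMSEQ_one_over_Suc)
        then have "(\<lambda>n. a + 1 / real (Suc n) * y) \<longlonglongrightarrow> a"
          by simp
        then have "(\<lambda>n. h (a + 1 / real (Suc n) * y)) \<longlonglongrightarrow> h a"
          using ch by (intro isCont_tendsto_compose[of a h]) (auto simp: continuous_on_eq_continuous_at)
        \<comment> \<open>\<open>h1\<close> may jump at the edges of its window, but for fixed
          \<open>y\<close> the argument eventually stays inside, where \<open>h1\<close> agrees with
          \<open>h\<close>.\<close>
        moreover have "eventually (\<lambda>n. h (a + 1 / real (Suc n) * y) = h1 (a + 1 / real (Suc n) * y)) sequentially"
          using eventually_ge_at_top[of "nat \<lceil>\<bar>y\<bar>\<rceil>"]
        proof eventually_elim
          case (elim n)
          then have "\<bar>y\<bar> \<le> real (Suc n)" by linarith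
          then have "\<bar>1 / real (Suc n) * y\<bar> \<le> 1"
            by (simp add: abs_mult divide_le_eq del: of_nat_Suc)
          then have "a + 1 / real (Suc n) * y \<in> {a-1..a+1}"
            unfolding abs_le_iff atLeastAtMost_iff by linarith
          then show ?case
            by (simp add: h1_def)
        qed
        ultimately show "(\<lambda>n. h1 (a + 1 / real (Suc n) * y)) \<longlonglongrightarrow> h a"
          by (rule Lim_transform_eventually)
      qed
      show "AE y in lborel. norm (h1 (a + 1 / real (Suc n) * y) * std_normal_density y) \<le> B * std_normal_density y" for n
        using B by (auto simp: abs_mult intro!: AE_I2 mult_right_mono)
    qed simp_all
    then show ?thesis
      unfolding eq by simp
  qed
  have lim2: "(\<lambda>n. LINT x|lborel. h2 x * normal_density 0 (1 / real (Suc n)) (a - x)) \<longlonglongrightarrow> 0"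
  proof -
    define K where "K = (LINT x|lborel. \<bar>h x\<bar> * exp (- (a - x)\<^sup>2 / 4))"
    have intK: "integrable lborel (\<lambda>x. \<bar>h x\<bar> * exp (- (a - x)\<^sup>2 / 4))"
    proof -
      \<comment> \<open>Up to a factor the tail weight is a normal density of variance 2, so its
        product with \<open>h\<close> falls under \<open>int\<close>.\<close>
      have "exp (- (a - x)\<^sup>2 / 4) = sqrt (4 * pi) * normal_density 0 (sqrt 2) (a - x)" for x
        by (simp add: normal_density_def)
      then have *: "\<bar>h x\<bar> * exp (- (a - x)\<^sup>2 / 4) = sqrt (4 * pi) * \<bar>h x * normal_density 0 (sqrt 2) (a - x)\<bar>" for x
        by (simp add: abs_mult)
      show ?thesis
        unfolding * by (intro integrable_mult_right integrable_abs int) simp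
    qed
    have bd: "norm (LINT x|lborel. h2 x * normal_density 0 (1 / real (Suc n)) (a - x))
       \<le> real (Suc n) * exp (- (real (Suc n))\<^sup>2 / 4) * K" for n
    proof -
      have "norm (LINT x|lborel. h2 x * normal_density 0 (1 / real (Suc n)) (a - x))
         \<le> (LINT x|lborel. norm (h2 x * normal_density 0 (1 / real (Suc n)) (a - x)))"
        by (rule integral_norm_bound)
      also have "\<dots> \<le> (LINT x|lborel. real (Suc n) * exp (- (real (Suc n))\<^sup>2 / 4) * (\<bar>h x\<bar> * exp (- (a - x)\<^sup>2 / 4)))"
      proof (rule integral_mono)
        show "integrable lborel (\<lambda>x. norm (h2 x * normal_density 0 (1 / real (Suc n)) (a - x)))"
          by (intro integrable_norm int2) simp
        show "integrable lborel (\<lambda>x. real (Suc n) * exp (- (real (Suc n))\<^sup>2 / 4) * (\<bar>h x\<bar> * exp (- (a - x)\<^sup>2 / 4)))"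
          by (intro integrable_mult_right intK)
        fix x
        show "norm (h2 x * normal_density 0 (1 / real (Suc n)) (a - x))
          \<le> real (Suc n) * exp (- (real (Suc n))\<^sup>2 / 4) * (\<bar>h x\<bar> * exp (- (a - x)\<^sup>2 / 4))"
        proof (cases "x \<in> {a-1..a+1}")
          case False
          then have "\<bar>a - x\<bar> \<ge> 1" by auto
          from normal_density_tail[OF _ this, of "real (Suc n)"]
          have "\<bar>h x\<bar> * normal_density 0 (1 / real (Suc n)) (a - x)
             \<le> \<bar>h x\<bar> * (real (Suc n) * exp (- (real (Suc n))\<^sup>2 / 4) * exp (- (a - x)\<^sup>2 / 4))"
            by (intro mult_left_mono) auto
          then show ?thesis
            using False by (simp add: h2_def abs_mult mult_ac del: of_nat_Suc)
        qed (simp add: h2_def)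
      qed
      finally show ?thesis
        by (simp add: K_def)
    qed
    have "(\<lambda>n. real n * exp (- (real n)\<^sup>2 / 4)) \<longlonglongrightarrow> 0"
      by real_asymp
    then have "(\<lambda>n. real (Suc n) * exp (- (real (Suc n))\<^sup>2 / 4) * K) \<longlonglongrightarrow> 0 * K"
      by (intro tendsto_mult tendsto_const) (rule LIMSEQ_Suc)
    then show ?thesis
      unfolding mult_zero_left by (rule Lim_null_comparison[OF always_eventually[OF allI[OF bd]]])
  qed
  have "h x * c = h1 x * c + h2 x * c" for x c
    by (simp add: h1_def h2_def algebra_simps)
  then have "(LINT x|lborel. h x * normal_density 0 (1 / real (Suc n)) (a - x)) =
     (LINT x|lborel. h1 x * normal_density 0 (1 / real (Suc n)) (a - x))
     + (LINT x|lborel. h2 x * normal_density 0 (1 / real (Suc n)) (a - x))" for n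
    by (simp only:) (rule Bochner_Integration.integral_add; rule int1 int2; simp)
  then show ?thesis
    using tendsto_add[OF lim1 lim2] by (simp only: add_0_right)
qed

text \<open>The Gaussian factor in \<open>has_fourier_L2_gaussian\<close> is made to fade: the
  integrable \<open>v\<close> dominates one side, and the other side is a mollification tending to
  \<open>h a\<close>. Continuity of \<open>h\<close> gives the formula at every point rather than
  almost everywhere.\<close>

theorem fourier_inversion:
  assumes h: "has_fourier_L2 h v" and v: "integrable lborel v" and ch: "continuous_on UNIV h"
  shows "complex_of_real (h a) = of_real (1 / sqrt (2 * pi)) * (LINT \<xi>|lborel. v \<xi> * cis (a * \<xi>))"
proof -
  have [measurable]: "v \<in> borel_measurable borel"
    using v by (auto dest: borel_measurable_integrable)
  have sh: "square_integrable h"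
    using h by (simp add: has_fourier_L2_def)
  define e where "e n = 1 / real (Suc n)" for n
  have e: "e n > 0" for n by (simp add: e_def)
  have "(\<lambda>n. complex_of_real (sqrt (2 * pi) * (LINT x|lborel. h x * normal_density 0 (e n) (a - x))))
     \<longlonglongrightarrow> complex_of_real (sqrt (2 * pi) * h a)"
    unfolding e_def by (intro tendsto_intros normal_density_mollifier sh ch)
  then have "(\<lambda>n. LINT \<xi>|lborel. v \<xi> * (cis (a * \<xi>) * of_real (exp (- (e n * \<xi>)\<^sup>2 / 2))))
     \<longlonglongrightarrow> complex_of_real (sqrt (2 * pi) * h a)"
    by (simp only: has_fourier_L2_gaussian[OF h e])
  moreover have "(\<lambda>n. LINT \<xi>|lborel. v \<xi> * (cis (a * \<xi>) * of_real (exp (- (e n * \<xi>)\<^sup>2 / 2))))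
     \<longlonglongrightarrow> (LINT \<xi>|lborel. v \<xi> * cis (a * \<xi>))"
  proof (rule integral_dominated_convergence)
    show "integrable lborel (\<lambda>\<xi>. norm (v \<xi>))"
      using v by (rule integrable_norm)
    show "AE \<xi> in lborel. (\<lambda>n. v \<xi> * (cis (a * \<xi>) * of_real (exp (- (e n * \<xi>)\<^sup>2 / 2)))) \<longlonglongrightarrow> v \<xi> * cis (a * \<xi>)"
    proof (rule AE_I2)
      fix \<xi>
      have "(\<lambda>n. exp (- (e n * \<xi>)\<^sup>2 / 2)) \<longlonglongrightarrow> exp (- (0 * \<xi>)\<^sup>2 / 2)"
        unfolding e_def by (intro tendsto_intros LIMSEQ_one_over_Suc) simp
      then have "(\<lambda>n. exp (- (e n * \<xi>)\<^sup>2 / 2)) \<longlonglongrightarrow> 1"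
        by simp
      then have "(\<lambda>n. v \<xi> * (cis (a * \<xi>) * of_real (exp (- (e n * \<xi>)\<^sup>2 / 2)))) \<longlonglongrightarrow> v \<xi> * (cis (a * \<xi>) * of_real 1)"
        by (intro tendsto_intros)
      then show "(\<lambda>n. v \<xi> * (cis (a * \<xi>) * of_real (exp (- (e n * \<xi>)\<^sup>2 / 2)))) \<longlonglongrightarrow> v \<xi> * cis (a * \<xi>)"
        by simp
    qed
    show "AE \<xi> in lborel. norm (v \<xi> * (cis (a * \<xi>) * of_real (exp (- (e n * \<xi>)\<^sup>2 / 2)))) \<le> norm (v \<xi>)" for n
      by (auto simp: norm_mult intro!: AE_I2 mult_left_le)
  qed simp_all
  ultimately have "complex_of_real (sqrt (2 * pi) * h a) = (LINT \<xi>|lborel. v \<xi> * cis (a * \<xi>))"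
    by (rule LIMSEQ_unique)
  then show ?thesis
    by (simp flip: of_real_mult add: field_simps)
qed

section \<open>Linearity and uniqueness of the L^2 transform; the Sobolev norm\<close>

lemma norm_diff_power2_le:
  fixes a b :: "'a::real_normed_vector"
  shows "(norm (a - b))\<^sup>2 \<le> 2 * (norm a)\<^sup>2 + 2 * (norm b)\<^sup>2"
proof -
  have "(norm (a - b))\<^sup>2 \<le> (norm a + norm b)\<^sup>2"
    by (intro power_mono norm_triangle_ineq4) simp
  also have "\<dots> \<le> 2 * (norm a)\<^sup>2 + 2 * (norm b)\<^sup>2"
    using zero_le_power2[of "norm a - norm b"] unfolding power2_sum power2_diff by linarith
  finally show ?thesis .
qed

lemma square_integrable_diff:
  fixes v w :: "real \<Rightarrow> 'a::{banach, second_countable_topology}"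
  assumes "square_integrable v" "square_integrable w"
  shows "square_integrable (\<lambda>x. v x - w x)"
  unfolding square_integrable_def
proof
  have [measurable]: "v \<in> borel_measurable borel" "w \<in> borel_measurable borel"
    using assms by (auto simp: square_integrable_def)
  show "(\<lambda>x. v x - w x) \<in> borel_measurable lborel" by simp
  have "integrable lborel (\<lambda>x. 2 * (norm (v x))\<^sup>2 + 2 * (norm (w x))\<^sup>2)"
    using assms by (auto simp: square_integrable_def)
  then show "integrable lborel (\<lambda>x. (norm (v x - w x))\<^sup>2)"
    by (rule Bochner_Integration.integrable_bound)
      (use norm_diff_power2_le in \<open>auto intro!: AE_I2\<close>)
qed

lemma truncated_fourier_diff:
  assumes h: "square_integrable h" and k: "square_integrable k"
  shows "truncated_fourier n (\<lambda>x. h x - k x) \<xi> = truncated_fourier n h \<xi> - truncated_fourier n k \<xi>"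
proof -
  have int: "integrable lborel (\<lambda>x. cis (- (\<xi> * x)) * complex_of_real (indicator {-real n..real n} x * h x))"
    if "square_integrable h" for h
  proof -
    have [measurable]: "h \<in> borel_measurable borel"
      using that by (auto simp: square_integrable_def)
    show ?thesis
      by (rule Bochner_Integration.integrable_bound[OF square_integrable_imp_integrable_truncation[OF that]])
        (auto simp: norm_mult abs_mult)
  qed
  have "(LINT x|lborel. cis (- (\<xi> * x)) * complex_of_real (indicator {-real n..real n} x * (h x - k x)))
     = (LINT x|lborel. cis (- (\<xi> * x)) * complex_of_real (indicator {-real n..real n} x * h x))
      - (LINT x|lborel. cis (- (\<xi> * x)) * complex_of_real (indicator {-real n..real n} x * k x))"
    by (subst Bochner_Integration.integral_diff[OF int[OF h] int[OF k], symmetric])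
      (intro Bochner_Integration.integral_cong, auto simp: algebra_simps)
  then show ?thesis
    unfolding truncated_fourier_eq by (simp add: right_diff_distrib)
qed

lemma tendsto_nn_integral_norm_diff_power2:
  fixes F G :: "nat \<Rightarrow> real \<Rightarrow> 'a::{banach, second_countable_topology}"
  assumes [measurable]: "\<And>n. F n \<in> borel_measurable borel" "\<And>n. G n \<in> borel_measurable borel"
    and F: "(\<lambda>n. \<integral>\<^sup>+ x. ennreal ((norm (F n x))\<^sup>2) \<partial>lborel) \<longlonglongrightarrow> 0"
    and G: "(\<lambda>n. \<integral>\<^sup>+ x. ennreal ((norm (G n x))\<^sup>2) \<partial>lborel) \<longlonglongrightarrow> 0"
  shows "(\<lambda>n. \<integral>\<^sup>+ x. ennreal ((norm (F n x - G n x))\<^sup>2) \<partial>lborel) \<longlonglongrightarrow> 0"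
proof (rule tendsto_sandwich[OF _ _ tendsto_const])
  show "(\<lambda>n. 2 * (\<integral>\<^sup>+ x. ennreal ((norm (F n x))\<^sup>2) \<partial>lborel) + 2 * (\<integral>\<^sup>+ x. ennreal ((norm (G n x))\<^sup>2) \<partial>lborel)) \<longlonglongrightarrow> 0"
  proof -
    have "(\<lambda>n. 2 * (\<integral>\<^sup>+ x. ennreal ((norm (F n x))\<^sup>2) \<partial>lborel) + 2 * (\<integral>\<^sup>+ x. ennreal ((norm (G n x))\<^sup>2) \<partial>lborel)) \<longlonglongrightarrow> 2 * 0 + 2 * 0"
      by (intro tendsto_add tendsto_mult_ennreal tendsto_const F G) auto
    then show ?thesis by simp
  qed
  have "(\<integral>\<^sup>+ x. ennreal ((norm (F n x - G n x))\<^sup>2) \<partial>lborel)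
     \<le> (\<integral>\<^sup>+ x. 2 * ennreal ((norm (F n x))\<^sup>2) + 2 * ennreal ((norm (G n x))\<^sup>2) \<partial>lborel)" for n
  proof (rule nn_integral_mono)
    fix x
    have "ennreal ((norm (F n x - G n x))\<^sup>2) \<le> ennreal (2 * (norm (F n x))\<^sup>2 + 2 * (norm (G n x))\<^sup>2)"
      by (intro ennreal_leI norm_diff_power2_le)
    then show "ennreal ((norm (F n x - G n x))\<^sup>2) \<le> 2 * ennreal ((norm (F n x))\<^sup>2) + 2 * ennreal ((norm (G n x))\<^sup>2)"
      by (simp add: ennreal_plus ennreal_mult)
  qed
  also have "\<dots> n = 2 * (\<integral>\<^sup>+ x. ennreal ((norm (F n x))\<^sup>2) \<partial>lborel) + 2 * (\<integral>\<^sup>+ x. ennreal ((norm (G n x))\<^sup>2) \<partial>lborel)" for n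
    by (simp add: nn_integral_add nn_integral_cmult)
  finally show "\<forall>\<^sub>F n in sequentially. (\<integral>\<^sup>+ x. ennreal ((norm (F n x - G n x))\<^sup>2) \<partial>lborel)
     \<le> 2 * (\<integral>\<^sup>+ x. ennreal ((norm (F n x))\<^sup>2) \<partial>lborel) + 2 * (\<integral>\<^sup>+ x. ennreal ((norm (G n x))\<^sup>2) \<partial>lborel)"
    by simp
qed simp

lemma has_fourier_L2_diff:
  assumes "has_fourier_L2 h v" "has_fourier_L2 k w"
  shows "has_fourier_L2 (\<lambda>x. h x - k x) (\<lambda>\<xi>. v \<xi> - w \<xi>)"
proof -
  have *: "square_integrable h" "square_integrable k" "square_integrable v" "square_integrable w"
    using assms by (auto simp: has_fourier_L2_def)
  then have [measurable]: "h \<in> borel_measurable borel" "k \<in> borel_measurable borel"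
      "v \<in> borel_measurable borel" "w \<in> borel_measurable borel"
    by (auto simp: square_integrable_def)
  note [measurable] = borel_measurable_truncated_fourier
  have "(\<lambda>n. \<integral>\<^sup>+ \<xi>. ennreal ((norm ((truncated_fourier n h \<xi> - v \<xi>) - (truncated_fourier n k \<xi> - w \<xi>)))\<^sup>2) \<partial>lborel) \<longlonglongrightarrow> 0"
    by (rule tendsto_nn_integral_norm_diff_power2) (use assms in \<open>auto simp: has_fourier_L2_def\<close>)
  then show ?thesis
    unfolding has_fourier_L2_def
    by (simp add: truncated_fourier_diff * square_integrable_diff algebra_simps)
qed

lemma has_fourier_L2_unique:
  assumes "has_fourier_L2 h v" "has_fourier_L2 h w"
  shows "AE \<xi> in lborel. v \<xi> = w \<xi>"
proof -
  have "square_integrable h" "square_integrable v" "square_integrable w"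
    using assms by (auto simp: has_fourier_L2_def)
  then have [measurable]: "h \<in> borel_measurable borel" "v \<in> borel_measurable borel" "w \<in> borel_measurable borel"
    by (auto simp: square_integrable_def)
  note [measurable] = borel_measurable_truncated_fourier
  have "(\<lambda>n. \<integral>\<^sup>+ \<xi>. ennreal ((norm ((truncated_fourier n h \<xi> - v \<xi>) - (truncated_fourier n h \<xi> - w \<xi>)))\<^sup>2) \<partial>lborel) \<longlonglongrightarrow> 0"
    by (rule tendsto_nn_integral_norm_diff_power2) (use assms in \<open>auto simp: has_fourier_L2_def\<close>)
  \<comment> \<open>The truncated transforms cancel, so the sequence tending to 0 is
    constant.\<close>
  then have "(\<integral>\<^sup>+ \<xi>. ennreal ((norm (w \<xi> - v \<xi>))\<^sup>2) \<partial>lborel) = 0"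
    by (simp add: LIMSEQ_const_iff)
  then have "AE \<xi> in lborel. ennreal ((norm (w \<xi> - v \<xi>))\<^sup>2) = 0"
    by (subst (asm) nn_integral_0_iff_AE) auto
  then show ?thesis
    by eventually_elim (simp add: ennreal_eq_0_iff)
qed

lemma sobolev_diff:
  assumes "h \<in> sobolev s" "k \<in> sobolev s"
  shows "(\<lambda>x. h x - k x) \<in> sobolev s"
proof -
  obtain v where v: "has_fourier_L2 h v" "integrable lborel (\<lambda>\<xi>. (1 + \<xi>\<^sup>2) powr s * (norm (v \<xi>))\<^sup>2)"
    using assms(1) by (auto simp: sobolev_def)
  obtain w where w: "has_fourier_L2 k w" "integrable lborel (\<lambda>\<xi>. (1 + \<xi>\<^sup>2) powr s * (norm (w \<xi>))\<^sup>2)"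
    using assms(2) by (auto simp: sobolev_def)
  have [measurable]: "v \<in> borel_measurable borel" "w \<in> borel_measurable borel"
    using v w by (auto simp: has_fourier_L2_def square_integrable_def)
  have "integrable lborel (\<lambda>\<xi>. 2 * ((1 + \<xi>\<^sup>2) powr s * (norm (v \<xi>))\<^sup>2) + 2 * ((1 + \<xi>\<^sup>2) powr s * (norm (w \<xi>))\<^sup>2))"
    using v w by (intro Bochner_Integration.integrable_add integrable_mult_right)
  then have "integrable lborel (\<lambda>\<xi>. (1 + \<xi>\<^sup>2) powr s * (norm (v \<xi> - w \<xi>))\<^sup>2)"
  proof (rule Bochner_Integration.integrable_bound)
    have "(1 + \<xi>\<^sup>2) powr s * (norm (v \<xi> - w \<xi>))\<^sup>2
      \<le> (1 + \<xi>\<^sup>2) powr s * (2 * (norm (v \<xi>))\<^sup>2 + 2 * (norm (w \<xi>))\<^sup>2)" for \<xi>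
      by (intro mult_left_mono norm_diff_power2_le) simp
    then show "AE \<xi> in lborel. norm ((1 + \<xi>\<^sup>2) powr s * (norm (v \<xi> - w \<xi>))\<^sup>2)
      \<le> norm (2 * ((1 + \<xi>\<^sup>2) powr s * (norm (v \<xi>))\<^sup>2) + 2 * ((1 + \<xi>\<^sup>2) powr s * (norm (w \<xi>))\<^sup>2))"
      by (auto simp: algebra_simps)
  qed simp
  then show ?thesis
    using has_fourier_L2_diff[OF v(1) w(1)] unfolding sobolev_def by blast
qed

text \<open>The norm is built on the transform picked by \<open>SOME\<close>, membership in
  \<open>sobolev s\<close> on some transform. Uniqueness up to null sets carries the integrability
  over to the picked one; otherwise the integral in \<open>sobolev_norm\<close> could be the default
  value 0.\<close>

lemma sobolev_norm_transform:
  assumes "h \<in> sobolev s"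
  obtains v where "has_fourier_L2 h v" "integrable lborel (\<lambda>\<xi>. (1 + \<xi>\<^sup>2) powr s * (norm (v \<xi>))\<^sup>2)"
    "(sobolev_norm s h)\<^sup>2 = (LINT \<xi>|lborel. (1 + \<xi>\<^sup>2) powr s * (norm (v \<xi>))\<^sup>2)" "sobolev_norm s h \<ge> 0"
proof -
  obtain v where v: "has_fourier_L2 h v" "integrable lborel (\<lambda>\<xi>. (1 + \<xi>\<^sup>2) powr s * (norm (v \<xi>))\<^sup>2)"
    using assms(1) by (auto simp: sobolev_def)
  define w where "w = (SOME v. has_fourier_L2 h v)"
  have w: "has_fourier_L2 h w"
    unfolding w_def using v(1) someI_ex[of "has_fourier_L2 h"] by blast
  have [measurable]: "v \<in> borel_measurable borel" "w \<in> borel_measurable borel"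
    using v w by (auto simp: has_fourier_L2_def square_integrable_def)
  have "AE \<xi> in lborel. (1 + \<xi>\<^sup>2) powr s * (norm (v \<xi>))\<^sup>2 = (1 + \<xi>\<^sup>2) powr s * (norm (w \<xi>))\<^sup>2"
    using has_fourier_L2_unique[OF v(1) w] by eventually_elim simp
  then have "integrable lborel (\<lambda>\<xi>. (1 + \<xi>\<^sup>2) powr s * (norm (w \<xi>))\<^sup>2)"
    using v(2) by (subst (asm) integrable_cong_AE) auto
  moreover have "0 \<le> (LINT \<xi>|lborel. (1 + \<xi>\<^sup>2) powr s * (norm (w \<xi>))\<^sup>2)"
    by (rule Bochner_Integration.integral_nonneg) simp
  ultimately show ?thesis
    using that[OF w] by (simp add: sobolev_norm_def w_def)
qed

section \<open>Embedding of H^s, s > 3/2, into bounded C^1 functions\<close>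

lemma integrable_one_plus_square_powr:
  assumes "r < - 1 / 2"
  shows "integrable lborel (\<lambda>x::real. (1 + x\<^sup>2) powr r)"
proof -
  define g where "g x = indicator {0..} x * (1 + x) powr (2 * r)" for x :: real
  have "(\<integral>\<^sup>+x. ennreal ((1 + x) powr (2 * r)) * indicator {0..} x \<partial>lborel)
     = ennreal (0 - (1 + 0) powr (2 * r + 1) / (2 * r + 1))"
  proof (rule nn_integral_FTC_atLeast)
    show "((\<lambda>x. (1 + x) powr (2 * r + 1) / (2 * r + 1)) has_real_derivative (1 + x) powr (2 * r)) (at x)" if "0 \<le> x" for x
    proof -
      define p where "p = 2 * r + 1"
      have "((\<lambda>x. (1 + x) powr p / p) has_real_derivative (p * (1 + x) powr (p - 1)) / p) (at x)"
        using that assms by (auto intro!: derivative_eq_intros)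
      then show ?thesis
        using assms by (simp add: p_def)
    qed
    have "((\<lambda>x::real. (1 + x) powr (2 * r + 1)) \<longlongrightarrow> 0) at_top"
      using assms by (intro tendsto_neg_powr filterlim_tendsto_add_at_top[OF tendsto_const filterlim_ident]) auto
    from tendsto_divide[OF this tendsto_const[of "2 * r + 1"]]
    show "((\<lambda>x. (1 + x) powr (2 * r + 1) / (2 * r + 1)) \<longlongrightarrow> 0) at_top"
      using assms by simp
  qed auto
  also have "\<dots> < \<infinity>" by simp
  finally have g: "integrable lborel g"
    unfolding g_def by (subst integrable_iff_bounded) (auto simp: ennreal_mult' ennreal_indicator abs_mult mult.commute)
  have "integrable lborel (\<lambda>x. g (0 + (-1) * x))"
    by (rule lborel_integrable_real_affine[OF g]) simp
  with g have "integrable lborel (\<lambda>x. 2 powr (- r) * (g x + g (0 + (-1) * x)))"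
    by (intro integrable_mult_right Bochner_Integration.integrable_add)
  then show ?thesis
  proof (rule Bochner_Integration.integrable_bound)
    have "(1 + x\<^sup>2) powr r \<le> 2 powr (- r) * (g x + g (0 + (-1) * x))" for x
    proof -
      \<comment> \<open>As \<open>r\<close> is negative, this reduces the claim to
        \<open>(1 + \<bar>x\<bar>) powr (2 * r)\<close>, which has an elementary antiderivative on
        each half line and is integrable since \<open>2 * r < -1\<close>.\<close>
      have "(1 + \<bar>x\<bar>)\<^sup>2 / 2 \<le> 1 + x\<^sup>2"
        using zero_le_power2[of "1 - \<bar>x\<bar>"] by (simp add: power2_sum power2_diff)
      then have "(1 + x\<^sup>2) powr r \<le> ((1 + \<bar>x\<bar>)\<^sup>2 / 2) powr r"
        using assms by (intro powr_mono2') auto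
      also have "\<dots> = ((1 + \<bar>x\<bar>) powr 2) powr r / 2 powr r"
        by (simp add: powr_divide flip: powr_numeral)
      also have "\<dots> = 2 powr (- r) * (1 + \<bar>x\<bar>) powr (2 * r)"
        unfolding powr_powr by (simp add: powr_minus_divide)
      also have "\<dots> \<le> 2 powr (- r) * (g x + g (0 + (-1) * x))"
        by (intro mult_left_mono) (auto simp: g_def indicator_def)
      finally show ?thesis .
    qed
    then show "AE x in lborel. norm ((1 + x\<^sup>2) powr r) \<le> norm (2 powr (- r) * (g x + g (0 + (-1) * x)))"
      by (intro AE_I2) (metis abs_ge_self abs_of_nonneg order_trans powr_ge_zero real_norm_def)
  qed simp
qed

lemma norm_cis_diff_le: "norm (cis s - cis t) \<le> \<bar>s - t\<bar>"
proof -
  have "cis s - cis t = cis t * (cis (s - t) - 1)"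
    by (simp add: algebra_simps cis_mult)
  then have "norm (cis s - cis t) = norm (iexp (s - t) - 1)"
    by (simp add: norm_mult cis_conv_exp)
  also have "\<dots> \<le> \<bar>s - t\<bar>"
    using iexp_approx1[of "s - t" 0] by simp
  finally show ?thesis .
qed

text \<open>The integral bound is the Cauchy-Schwarz inequality, in the form
  \<open>2 a b \<le> \<eta> a\<^sup>2 + b\<^sup>2 / \<eta>\<close> with \<open>\<eta>\<close> the Sobolev norm.\<close>

lemma sobolev_transform_L1:
  assumes "s > 3 / 2"
  obtains K where "K \<ge> 0" "\<And>h. h \<in> sobolev s \<Longrightarrow> \<exists>v. has_fourier_L2 h v \<and>
     integrable lborel (\<lambda>\<xi>. (1 + \<bar>\<xi>\<bar>) * norm (v \<xi>)) \<and>
     (LINT \<xi>|lborel. (1 + \<bar>\<xi>\<bar>) * norm (v \<xi>)) \<le> K * sobolev_norm s h"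
proof -
  define J where "J = (LINT \<xi>|lborel. (1 + \<xi>\<^sup>2) powr (1 - s))"
  \<comment> \<open>The exponent \<open>1 - s\<close> lies below \<open>- 1 / 2\<close> exactly when
    \<open>s > 3 / 2\<close>: this is the origin of the threshold.\<close>
  have intJ: "integrable lborel (\<lambda>\<xi>::real. (1 + \<xi>\<^sup>2) powr (1 - s))"
    by (rule integrable_one_plus_square_powr) (use assms in simp)
  have J: "J \<ge> 0"
    unfolding J_def by (rule Bochner_Integration.integral_nonneg) simp
  have "\<exists>v. has_fourier_L2 h v \<and>
     integrable lborel (\<lambda>\<xi>. (1 + \<bar>\<xi>\<bar>) * norm (v \<xi>)) \<and>
     (LINT \<xi>|lborel. (1 + \<bar>\<xi>\<bar>) * norm (v \<xi>)) \<le> (J + 1) * sobolev_norm s h" if h: "h \<in> sobolev s" for h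
  proof -
    define N where "N = sobolev_norm s h"
    obtain v where v: "has_fourier_L2 h v" "integrable lborel (\<lambda>\<xi>. (1 + \<xi>\<^sup>2) powr s * (norm (v \<xi>))\<^sup>2)"
      "N\<^sup>2 = (LINT \<xi>|lborel. (1 + \<xi>\<^sup>2) powr s * (norm (v \<xi>))\<^sup>2)" "N \<ge> 0"
      unfolding N_def by (rule sobolev_norm_transform[OF h])
    have [measurable]: "v \<in> borel_measurable borel"
      using v by (auto simp: has_fourier_L2_def square_integrable_def)
    have le: "(1 + \<bar>\<xi>\<bar>) * norm (v \<xi>) \<le> \<eta> * (1 + \<xi>\<^sup>2) powr (1 - s) + (1 + \<xi>\<^sup>2) powr s * (norm (v \<xi>))\<^sup>2 / \<eta>"
      if "\<eta> > 0" for \<xi> \<eta>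
    proof -
      define W where "W = 1 + \<xi>\<^sup>2"
      have W: "W > 0"
        unfolding W_def by (simp add: add_pos_nonneg)
      \<comment> \<open>\<open>sqrt W * norm (v \<xi>)\<close> controls the transform with the
        weight \<open>1 + \<bar>\<xi>\<bar>\<close> of one derivative. It is split into a square
        root of the integrable \<open>W powr (1 - s)\<close> and a square root of the density of the
        Sobolev norm.\<close>
      define A where "A = sqrt \<eta> * W powr ((1 - s) / 2)"
      define B where "B = W powr (s / 2) * norm (v \<xi>) / sqrt \<eta>"
      have p: "(W powr (r / 2))\<^sup>2 = W powr r" for r
        using W by (simp add: power2_eq_square flip: powr_add)
      have A2: "A\<^sup>2 = \<eta> * W powr (1 - s)"
        using \<open>\<eta> > 0\<close> by (simp add: A_def power_mult_distrib p)
      have B2: "B\<^sup>2 = W powr s * (norm (v \<xi>))\<^sup>2 / \<eta>"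
        using \<open>\<eta> > 0\<close> by (simp add: B_def power_mult_distrib power_divide p)
      have "A * B = (W powr ((1 - s) / 2) * W powr (s / 2)) * norm (v \<xi>)"
        using \<open>\<eta> > 0\<close> by (simp add: A_def B_def)
      also have "W powr ((1 - s) / 2) * W powr (s / 2) = W powr (1 / 2)"
        unfolding powr_add[symmetric] by (simp add: field_simps)
      also have "W powr (1 / 2) = sqrt W"
        using W by (simp add: powr_half_sqrt)
      finally have AB: "A * B = sqrt W * norm (v \<xi>)" .
      have "(1 + \<bar>\<xi>\<bar>)\<^sup>2 \<le> 4 * W"
        using zero_le_power2[of "1 - \<bar>\<xi>\<bar>"] zero_le_power2[of \<xi>] unfolding power2_sum power2_diff W_def
        by simp
      then have "1 + \<bar>\<xi>\<bar> \<le> 2 * sqrt W"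
        by (metis real_le_rsqrt real_sqrt_four real_sqrt_mult)
      then have "(1 + \<bar>\<xi>\<bar>) * norm (v \<xi>) \<le> 2 * sqrt W * norm (v \<xi>)"
        by (rule mult_right_mono) simp
      also have "\<dots> \<le> A\<^sup>2 + B\<^sup>2"
        using zero_le_power2[of "A - B"] unfolding power2_diff AB[symmetric] mult.assoc by linarith
      finally show ?thesis
        by (simp add: A2 B2 W_def)
    qed
    have int: "integrable lborel (\<lambda>\<xi>. \<eta> * (1 + \<xi>\<^sup>2) powr (1 - s) + (1 + \<xi>\<^sup>2) powr s * (norm (v \<xi>))\<^sup>2 / \<eta>)" for \<eta>
      using v(2) intJ by (intro Bochner_Integration.integrable_add integrable_mult_right integrable_divide)
    have int1: "integrable lborel (\<lambda>\<xi>. (1 + \<bar>\<xi>\<bar>) * norm (v \<xi>))"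
    proof (rule Bochner_Integration.integrable_bound[OF int[of 1]])
      show "AE \<xi> in lborel. norm ((1 + \<bar>\<xi>\<bar>) * norm (v \<xi>))
         \<le> norm (1 * (1 + \<xi>\<^sup>2) powr (1 - s) + (1 + \<xi>\<^sup>2) powr s * (norm (v \<xi>))\<^sup>2 / 1)"
        using le[of 1] by (intro AE_I2) (simp add: abs_mult)
    qed simp
    define X where "X = (LINT \<xi>|lborel. (1 + \<bar>\<xi>\<bar>) * norm (v \<xi>))"
    have X: "X \<le> \<eta> * J + N\<^sup>2 / \<eta>" if "\<eta> > 0" for \<eta>
    proof -
      have "X \<le> (LINT \<xi>|lborel. \<eta> * (1 + \<xi>\<^sup>2) powr (1 - s) + (1 + \<xi>\<^sup>2) powr s * (norm (v \<xi>))\<^sup>2 / \<eta>)"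
        unfolding X_def by (rule integral_mono[OF int1 int le[OF that]])
      also have "\<dots> = \<eta> * J + N\<^sup>2 / \<eta>"
        using v(2) intJ by (simp add: J_def v(3))
      finally show ?thesis .
    qed
    have "X \<le> (J + 1) * N"
    proof (rule field_le_epsilon)
      fix e :: real assume "e > 0"
      \<comment> \<open>The natural choice \<open>\<eta> = N\<close> is not admissible for
        \<open>N = 0\<close>; taking \<open>\<eta> = N + d\<close> costs
        \<open>d * (J + 1) = e\<close>.\<close>
      define d where "d = e / (J + 1)"
      have "d > 0"
        using \<open>e > 0\<close> J by (simp add: d_def)
      then have "N + d > 0"
        using v(4) by simp
      have "N\<^sup>2 \<le> (N + d)\<^sup>2"
        using v(4) \<open>d > 0\<close> by (intro power_mono) auto
      then have "N\<^sup>2 / (N + d) \<le> N + d"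
        using \<open>N + d > 0\<close> by (simp add: divide_le_eq power2_eq_square)
      then have "X \<le> (N + d) * (J + 1)"
        using X[OF \<open>N + d > 0\<close>] by (simp add: algebra_simps)
      also have "\<dots> = (J + 1) * N + e"
        using J by (simp add: d_def field_simps)
      finally show "X \<le> (J + 1) * N + e" .
    qed
    then show ?thesis
      using v(1) int1 unfolding X_def N_def by blast
  qed
  then show ?thesis
    using that[of "J + 1"] J by simp
qed

text \<open>Since \<open>h\<close> is differentiable by assumption, the inversion formula need only
  be applied to \<open>h\<close> and its increments: first differences bound \<open>deriv h\<close>,
  second differences give its modulus of continuity, and both bounds survive the limit of difference
  quotients. Uniform continuity later yields the decay of the derivative at infinity.\<close>

theorem sobolev_embedding:
  assumes "s > 3 / 2"
  obtains K where "K \<ge> 0"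
    "\<And>h x. \<lbrakk>h \<in> sobolev s; \<And>x. h differentiable at x\<rbrakk> \<Longrightarrow> \<bar>h x\<bar> \<le> K * sobolev_norm s h"
    "\<And>h x. \<lbrakk>h \<in> sobolev s; \<And>x. h differentiable at x\<rbrakk> \<Longrightarrow> \<bar>deriv h x\<bar> \<le> K * sobolev_norm s h"
    "\<And>h. \<lbrakk>h \<in> sobolev s; \<And>x. h differentiable at x\<rbrakk> \<Longrightarrow> uniformly_continuous_on UNIV (deriv h)"
proof -
  obtain K where K: "K \<ge> 0" "\<And>h. h \<in> sobolev s \<Longrightarrow> \<exists>v. has_fourier_L2 h v \<and>
     integrable lborel (\<lambda>\<xi>. (1 + \<bar>\<xi>\<bar>) * norm (v \<xi>)) \<and>
     (LINT \<xi>|lborel. (1 + \<bar>\<xi>\<bar>) * norm (v \<xi>)) \<le> K * sobolev_norm s h"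
    using sobolev_transform_L1[OF assms] by blast
  have main: "\<bar>h x\<bar> \<le> K * sobolev_norm s h \<and> \<bar>deriv h x\<bar> \<le> K * sobolev_norm s h \<and>
      uniformly_continuous_on UNIV (deriv h)"
    if h: "h \<in> sobolev s" and dh: "\<And>x. h differentiable at x" for h x
  proof -
    obtain v where v: "has_fourier_L2 h v"
      and int: "integrable lborel (\<lambda>\<xi>. (1 + \<bar>\<xi>\<bar>) * norm (v \<xi>))"
      and le: "(LINT \<xi>|lborel. (1 + \<bar>\<xi>\<bar>) * norm (v \<xi>)) \<le> K * sobolev_norm s h"
      using K(2)[OF h] by blast
    define X where "X = (LINT \<xi>|lborel. (1 + \<bar>\<xi>\<bar>) * norm (v \<xi>))"
    have [measurable]: "v \<in> borel_measurable borel"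
      using v by (auto simp: has_fourier_L2_def square_integrable_def)
    have ch: "continuous_on UNIV h"
      using dh by (auto intro!: continuous_at_imp_continuous_on differentiable_imp_continuous_within)
    have intv: "integrable lborel v"
      by (rule Bochner_Integration.integrable_bound[OF int]) (auto simp: abs_mult algebra_simps)
    have intc: "integrable lborel (\<lambda>\<xi>. v \<xi> * cis (a * \<xi>))" for a
      by (rule Bochner_Integration.integrable_bound[OF intv]) (auto simp: norm_mult)
    define c where "c = 1 / sqrt (2 * pi)"
    have c: "0 \<le> c" "c \<le> 1"
      using pi_ge_two by (auto simp: c_def divide_le_eq)
    have inv: "complex_of_real (h a) = of_real c * (LINT \<xi>|lborel. v \<xi> * cis (a * \<xi>))" for a
      unfolding c_def by (rule fourier_inversion[OF v intv ch])
    \<comment> \<open>All estimates below go through the integral formula in this way; the factor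
      \<open>c\<close> is at most 1 and is dropped.\<close>
    have bound: "\<bar>r\<bar> \<le> Y" if "complex_of_real r = of_real c * (LINT \<xi>|lborel. F \<xi>)"
        "integrable lborel F" "integrable lborel G" "\<And>\<xi>. norm (F \<xi>) \<le> G \<xi>" "(LINT \<xi>|lborel. G \<xi>) = Y"
        for r Y F and G :: "real \<Rightarrow> real"
    proof -
      have "\<bar>r\<bar> = norm (complex_of_real r)" by simp
      also have "\<dots> = c * norm (LINT \<xi>|lborel. F \<xi>)"
        using c by (simp add: that(1) norm_mult)
      also have "\<dots> \<le> 1 * (LINT \<xi>|lborel. G \<xi>)"
        using c that by (intro mult_mono Bochner_Integration.integral_norm_bound_integral) auto
      finally show ?thesis
        using that(5) by simp
    qed
    have h_le: "\<bar>h a\<bar> \<le> X" for a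
      by (rule bound[OF inv intc int _ X_def[symmetric]]) (simp add: norm_mult algebra_simps)
    have lip: "\<bar>h a - h b\<bar> \<le> \<bar>a - b\<bar> * X" for a b
    proof (rule bound[OF _ Bochner_Integration.integrable_diff[OF intc[of a] intc[of b]]])
      show "complex_of_real (h a - h b) = of_real c * (LINT \<xi>|lborel. v \<xi> * cis (a * \<xi>) - v \<xi> * cis (b * \<xi>))"
        by (simp add: inv intc right_diff_distrib)
      show "integrable lborel (\<lambda>\<xi>. \<bar>a - b\<bar> * ((1 + \<bar>\<xi>\<bar>) * norm (v \<xi>)))"
        using int by (rule integrable_mult_right)
      show "(LINT \<xi>|lborel. \<bar>a - b\<bar> * ((1 + \<bar>\<xi>\<bar>) * norm (v \<xi>))) = \<bar>a - b\<bar> * X"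
        by (simp add: X_def)
      fix \<xi>
      have "norm (v \<xi> * cis (a * \<xi>) - v \<xi> * cis (b * \<xi>)) = norm (v \<xi>) * norm (cis (a * \<xi>) - cis (b * \<xi>))"
        by (simp add: right_diff_distrib[symmetric] norm_mult)
      also have "\<dots> \<le> norm (v \<xi>) * \<bar>a * \<xi> - b * \<xi>\<bar>"
        by (intro mult_left_mono norm_cis_diff_le) simp
      also have "\<dots> = \<bar>a - b\<bar> * (\<bar>\<xi>\<bar> * norm (v \<xi>))"
        by (simp add: left_diff_distrib[symmetric] abs_mult)
      also have "\<dots> \<le> \<bar>a - b\<bar> * ((1 + \<bar>\<xi>\<bar>) * norm (v \<xi>))"
        by (intro mult_left_mono mult_right_mono) auto
      finally show "norm (v \<xi> * cis (a * \<xi>) - v \<xi> * cis (b * \<xi>)) \<le> \<bar>a - b\<bar> * ((1 + \<bar>\<xi>\<bar>) * norm (v \<xi>))" .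
    qed
    have deriv_lim: "((\<lambda>k. (h (a + k) - h a) / k) \<longlongrightarrow> deriv h a) (at 0)" for a
      using dh[of a] DERIV_deriv_iff_real_differentiable[of h a] by (simp add: DERIV_def)
    have h'_le: "\<bar>deriv h a\<bar> \<le> X" for a
    proof (rule tendsto_upperbound[OF tendsto_rabs[OF deriv_lim[of a]]])
      show "\<forall>\<^sub>F k in at 0. \<bar>(h (a + k) - h a) / k\<bar> \<le> X"
        unfolding eventually_at_filter
        using lip[of "a + _" a] by (intro always_eventually) (simp add: divide_le_eq mult.commute)
    qed simp
    \<comment> \<open>A majorant for the change of \<open>deriv h\<close> under a shift by
      \<open>d\<close>. It involves no base point, so its limit 0 at 0 means uniform
      continuity.\<close>
    define m where "m d = (LINT \<xi>|lborel. (1 + \<bar>\<xi>\<bar>) * norm (v \<xi>) * norm (cis (d * \<xi>) - 1))" for d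
    have intm: "integrable lborel (\<lambda>\<xi>. (1 + \<bar>\<xi>\<bar>) * norm (v \<xi>) * norm (cis (d * \<xi>) - 1))" for d
    proof (rule Bochner_Integration.integrable_bound[OF integrable_mult_right[OF int, of 2]])
      have "norm (cis (d * \<xi>) - 1) \<le> 2" for \<xi>
        using norm_triangle_ineq4[of "cis (d * \<xi>)" 1] by simp
      then show "AE \<xi> in lborel. norm ((1 + \<bar>\<xi>\<bar>) * norm (v \<xi>) * norm (cis (d * \<xi>) - 1))
          \<le> norm (2 * ((1 + \<bar>\<xi>\<bar>) * norm (v \<xi>)))"
        by (intro AE_I2) (simp add: abs_mult mult.commute mult_right_mono)
    qed simp
    have lip2: "\<bar>(h (a + k) - h a) - (h (b + k) - h b)\<bar> \<le> \<bar>k\<bar> * m (a - b)" for a b k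
    proof (rule bound[OF _ Bochner_Integration.integrable_diff[OF
          Bochner_Integration.integrable_diff[OF intc[of "a + k"] intc[of a]]
          Bochner_Integration.integrable_diff[OF intc[of "b + k"] intc[of b]]]])
      show "complex_of_real ((h (a + k) - h a) - (h (b + k) - h b)) = of_real c * (LINT \<xi>|lborel.
          v \<xi> * cis ((a + k) * \<xi>) - v \<xi> * cis (a * \<xi>) - (v \<xi> * cis ((b + k) * \<xi>) - v \<xi> * cis (b * \<xi>)))"
        by (simp add: inv intc right_diff_distrib)
      show "integrable lborel (\<lambda>\<xi>. \<bar>k\<bar> * ((1 + \<bar>\<xi>\<bar>) * norm (v \<xi>) * norm (cis ((a - b) * \<xi>) - 1)))"
        using intm by (rule integrable_mult_right)
      show "(LINT \<xi>|lborel. \<bar>k\<bar> * ((1 + \<bar>\<xi>\<bar>) * norm (v \<xi>) * norm (cis ((a - b) * \<xi>) - 1))) = \<bar>k\<bar> * m (a - b)"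
        by (simp add: m_def)
      fix \<xi>
      have ca: "cis ((a + k) * \<xi>) = cis (a * \<xi>) * cis (k * \<xi>)" "cis ((b + k) * \<xi>) = cis (b * \<xi>) * cis (k * \<xi>)"
        "cis (a * \<xi>) = cis (b * \<xi>) * cis ((a - b) * \<xi>)"
        by (simp_all add: cis_mult algebra_simps)
      \<comment> \<open>A second difference of a character is a product of two first differences:
        the step \<open>k\<close> contributes at most
        \<open>\<bar>k\<bar> * \<bar>\<xi>\<bar>\<close>, and the shift \<open>a - b\<close>
        contributes the factor kept in \<open>m\<close>.\<close>
      have "v \<xi> * cis ((a + k) * \<xi>) - v \<xi> * cis (a * \<xi>) - (v \<xi> * cis ((b + k) * \<xi>) - v \<xi> * cis (b * \<xi>))
         = v \<xi> * cis (b * \<xi>) * (cis (k * \<xi>) - cis 0) * (cis ((a - b) * \<xi>) - 1)"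
        unfolding ca cis_zero by (simp add: algebra_simps)
      then have "norm (v \<xi> * cis ((a + k) * \<xi>) - v \<xi> * cis (a * \<xi>) - (v \<xi> * cis ((b + k) * \<xi>) - v \<xi> * cis (b * \<xi>)))
        = norm (v \<xi>) * norm (cis (k * \<xi>) - cis 0) * norm (cis ((a - b) * \<xi>) - 1)"
        by (simp only: norm_mult norm_cis mult_1_right)
      also have "\<dots> \<le> norm (v \<xi>) * \<bar>k * \<xi> - 0\<bar> * norm (cis ((a - b) * \<xi>) - 1)"
        by (intro mult_left_mono mult_right_mono norm_cis_diff_le) simp_all
      also have "\<dots> = \<bar>k\<bar> * (\<bar>\<xi>\<bar> * norm (v \<xi>) * norm (cis ((a - b) * \<xi>) - 1))"
        by (simp add: abs_mult)
      also have "\<dots> \<le> \<bar>k\<bar> * ((1 + \<bar>\<xi>\<bar>) * norm (v \<xi>) * norm (cis ((a - b) * \<xi>) - 1))"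
        by (intro mult_left_mono mult_right_mono) auto
      finally show "norm (v \<xi> * cis ((a + k) * \<xi>) - v \<xi> * cis (a * \<xi>) - (v \<xi> * cis ((b + k) * \<xi>) - v \<xi> * cis (b * \<xi>)))
        \<le> \<bar>k\<bar> * ((1 + \<bar>\<xi>\<bar>) * norm (v \<xi>) * norm (cis ((a - b) * \<xi>) - 1))" .
    qed
    have h'_m: "\<bar>deriv h a - deriv h b\<bar> \<le> m (a - b)" for a b
    proof (rule tendsto_upperbound[OF tendsto_rabs[OF tendsto_diff[OF deriv_lim[of a] deriv_lim[of b]]]])
      have "\<bar>(h (a + k) - h a) / k - (h (b + k) - h b) / k\<bar> \<le> m (a - b)" if "k \<noteq> 0" for k
        using lip2[of a k b] that unfolding diff_divide_distrib[symmetric] abs_divide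
        by (simp add: divide_le_eq mult.commute)
      then show "\<forall>\<^sub>F k in at 0. \<bar>(h (a + k) - h a) / k - (h (b + k) - h b) / k\<bar> \<le> m (a - b)"
        unfolding eventually_at_filter by (intro always_eventually) auto
    qed simp
    have m0: "(m \<longlongrightarrow> 0) (at 0)"
    proof (rule tendsto_at_iff_sequentially[THEN iffD2], intro allI impI)
      fix X :: "nat \<Rightarrow> real" assume "\<forall>i. X i \<in> UNIV - {0}" and X: "X \<longlonglongrightarrow> 0"
      have "(\<lambda>n. m (X n)) \<longlonglongrightarrow> (LINT \<xi>::real|lborel. 0)"
        unfolding m_def
      proof (rule integral_dominated_convergence)
        show "integrable lborel (\<lambda>\<xi>. 2 * ((1 + \<bar>\<xi>\<bar>) * norm (v \<xi>)))"
          using int by (rule integrable_mult_right)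
        show "AE \<xi> in lborel. (\<lambda>n. (1 + \<bar>\<xi>\<bar>) * norm (v \<xi>) * norm (cis (X n * \<xi>) - 1)) \<longlonglongrightarrow> 0"
        proof (rule AE_I2)
          fix \<xi>
          have "(\<lambda>n. norm (cis (X n * \<xi>) - 1)) \<longlonglongrightarrow> 0"
          proof (rule Lim_null_comparison[OF always_eventually])
            show "\<forall>n. norm (norm (cis (X n * \<xi>) - 1)) \<le> \<bar>X n\<bar> * \<bar>\<xi>\<bar>"
              using norm_cis_diff_le[of "X _ * \<xi>" 0] by (simp add: abs_mult)
            show "(\<lambda>n. \<bar>X n\<bar> * \<bar>\<xi>\<bar>) \<longlonglongrightarrow> 0"
              using X by (intro tendsto_mult_left_zero tendsto_rabs_zero)
          qed
          then show "(\<lambda>n. (1 + \<bar>\<xi>\<bar>) * norm (v \<xi>) * norm (cis (X n * \<xi>) - 1)) \<longlonglongrightarrow> 0"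
            by (rule tendsto_mult_right_zero)
        qed
        fix n
        have le2: "(1 + \<bar>\<xi>\<bar>) * norm (v \<xi>) * norm (cis (X n * \<xi>) - 1) \<le> (1 + \<bar>\<xi>\<bar>) * norm (v \<xi>) * 2" for \<xi>
          using norm_triangle_ineq4[of "cis (X n * \<xi>)" 1] by (intro mult_left_mono) auto
        then show "AE \<xi> in lborel. norm ((1 + \<bar>\<xi>\<bar>) * norm (v \<xi>) * norm (cis (X n * \<xi>) - 1))
            \<le> 2 * ((1 + \<bar>\<xi>\<bar>) * norm (v \<xi>))"
          by (intro AE_I2) (simp add: abs_mult mult.commute[of 2])
      qed simp_all
      then show "(m \<circ> X) \<longlonglongrightarrow> 0" by (simp add: o_def)
    qed
    have "uniformly_continuous_on UNIV (deriv h)"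
      unfolding uniformly_continuous_on_def
    proof (intro allI impI)
      fix e :: real assume "e > 0"
      then obtain d where d: "d > 0" "\<And>t. t \<noteq> 0 \<Longrightarrow> \<bar>t\<bar> < d \<Longrightarrow> \<bar>m t\<bar> < e"
        using m0[unfolded LIM_def] by (auto simp: dist_real_def)
      show "\<exists>d>0. \<forall>x\<in>UNIV. \<forall>x'\<in>UNIV. dist x' x < d \<longrightarrow> dist (deriv h x') (deriv h x) < e"
      proof (intro exI[of _ d] conjI ballI impI d(1))
        fix x y :: real assume "dist y x < d"
        then show "dist (deriv h y) (deriv h x) < e"
          using d(2)[of "y - x"] h'_m[of y x] \<open>e > 0\<close> by (cases "y = x") (auto simp: dist_real_def)
      qed
    qed
    then show ?thesis
      using h_le[of x] h'_le[of x] le unfolding X_def by auto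
  qed
  show ?thesis
    by (rule that[OF K(1)]) (use main in blast)+
qed

section \<open>Convolution with the Helmholtz kernel\<close>

lemma convolve_reflect: "convolve k h x = (LINT y|lborel. k y * h (x - y))"
proof -
  have "convolve k h x = \<bar>-1\<bar> *\<^sub>R (LINT y|lborel. k (x - (x + (-1) * y)) * h (x + (-1) * y))"
    unfolding convolve_def by (rule lborel_integral_real_affine) simp
  then show ?thesis by simp
qed

lemma integrable_helmholtz_kernel: "integrable lborel helmholtz_kernel"
proof (rule Bochner_Integration.integrable_bound[OF integrable_one_plus_square_powr[of "-1"]])
  show "AE x in lborel. norm (helmholtz_kernel x) \<le> norm ((1 + x\<^sup>2) powr - 1)"
  proof (rule AE_I2)
    fix x :: real
    have "1 + x\<^sup>2 > 0"
      by (simp add: add_pos_nonneg)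
    have "1 + \<bar>x\<bar> + \<bar>x\<bar>\<^sup>2 / 2 \<le> exp \<bar>x\<bar>"
      by (rule exp_lower_Taylor_quadratic) simp
    then have "1 + x\<^sup>2 \<le> 2 * exp \<bar>x\<bar>"
      by simp
    then have "inverse (2 * exp \<bar>x\<bar>) \<le> inverse (1 + x\<^sup>2)"
      using \<open>1 + x\<^sup>2 > 0\<close> by (rule le_imp_inverse_le)
    then show "norm (helmholtz_kernel x) \<le> norm ((1 + x\<^sup>2) powr - 1)"
      using \<open>1 + x\<^sup>2 > 0\<close> by (simp add: helmholtz_kernel_def exp_minus powr_minus)
  qed
  show "helmholtz_kernel \<in> borel_measurable lborel"
    unfolding helmholtz_kernel_def[abs_def] by simp
qed simp

lemma helmholtz_kernel_pos: "helmholtz_kernel x > 0"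
  by (simp add: helmholtz_kernel_def)

lemma borel_measurable_helmholtz_kernel [measurable]:
  "helmholtz_kernel \<in> borel_measurable borel" "dx_helmholtz_kernel \<in> borel_measurable borel"
  unfolding helmholtz_kernel_def[abs_def] dx_helmholtz_kernel_def[abs_def] by simp_all

lemma abs_dx_helmholtz_kernel_le: "\<bar>dx_helmholtz_kernel x\<bar> \<le> helmholtz_kernel x"
  by (auto simp: dx_helmholtz_kernel_def abs_mult abs_sgn_eq helmholtz_kernel_def)

abbreviation kernel_mass :: real where
  "kernel_mass \<equiv> LINT x|lborel. helmholtz_kernel x"

lemma kernel_mass_nonneg: "0 \<le> kernel_mass"
  by (rule Bochner_Integration.integral_nonneg) (simp add: less_imp_le helmholtz_kernel_pos)

text \<open>Stated for any kernel dominated by p, so that p and its derivative are treated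
  alike.\<close>

lemma integrable_kernel_mult:
  assumes [measurable]: "k \<in> borel_measurable borel" "h \<in> borel_measurable borel"
    and k: "\<And>x. \<bar>k x\<bar> \<le> helmholtz_kernel x" and h: "\<And>x. \<bar>h x\<bar> \<le> M"
  shows "integrable lborel (\<lambda>y. k y * h (x - y))"
proof (rule Bochner_Integration.integrable_bound[OF integrable_mult_left[OF integrable_helmholtz_kernel, of M]])
  have "\<bar>k y * h (x - y)\<bar> \<le> helmholtz_kernel y * M" for y
    unfolding abs_mult by (intro mult_mono k h less_imp_le[OF helmholtz_kernel_pos]) simp
  then show "AE y in lborel. norm (k y * h (x - y)) \<le> norm (helmholtz_kernel y * M)"
    by (intro AE_I2) (metis abs_ge_self order_trans real_norm_def)
qed simp

lemma abs_convolve_le: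
  assumes [measurable]: "k \<in> borel_measurable borel" "h \<in> borel_measurable borel"
    and k: "\<And>x. \<bar>k x\<bar> \<le> helmholtz_kernel x" and h: "\<And>x. \<bar>h x\<bar> \<le> M"
  shows "\<bar>convolve k h x\<bar> \<le> kernel_mass * M"
proof -
  have "norm (LINT y|lborel. k y * h (x - y)) \<le> (LINT y|lborel. helmholtz_kernel y * M)"
  proof (rule Bochner_Integration.integral_norm_bound_integral)
    show "integrable lborel (\<lambda>y. k y * h (x - y))"
      by (rule integrable_kernel_mult[OF assms])
    show "integrable lborel (\<lambda>y. helmholtz_kernel y * M)"
      by (intro integrable_mult_left integrable_helmholtz_kernel)
    show "norm (k y * h (x - y)) \<le> helmholtz_kernel y * M" for y
      unfolding real_norm_def abs_mult by (intro mult_mono k h less_imp_le[OF helmholtz_kernel_pos]) simp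
  qed
  then show ?thesis
    by (simp add: convolve_reflect)
qed

text \<open>Function and point move together, as joint continuity in time and space requires. In the
  reflected form of the convolution the kernel stays fixed, and
  \<open>helmholtz_kernel y * M\<close> is a common majorant.\<close>

lemma tendsto_convolve:
  fixes H :: "nat \<Rightarrow> real \<Rightarrow> real" and X :: "nat \<Rightarrow> real"
  assumes k: "k \<in> borel_measurable borel" "\<And>x. \<bar>k x\<bar> \<le> helmholtz_kernel x"
    and [measurable]: "\<And>n. H n \<in> borel_measurable borel" "h \<in> borel_measurable borel"
    and H: "\<And>n x. \<bar>H n x\<bar> \<le> M"
    and lim: "\<And>y. (\<lambda>n. H n (X n - y)) \<longlonglongrightarrow> h (x - y)"
  shows "(\<lambda>n. convolve k (H n) (X n)) \<longlonglongrightarrow> convolve k h x"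
  unfolding convolve_reflect
proof (rule integral_dominated_convergence)
  note [measurable] = k(1)
  show "integrable lborel (\<lambda>y. helmholtz_kernel y * M)"
    by (intro integrable_mult_left integrable_helmholtz_kernel)
  show "AE y in lborel. norm (k y * H n (X n - y)) \<le> helmholtz_kernel y * M" for n
    unfolding real_norm_def abs_mult by (intro AE_I2 mult_mono k H less_imp_le[OF helmholtz_kernel_pos]) simp
  show "AE y in lborel. (\<lambda>n. k y * H n (X n - y)) \<longlonglongrightarrow> k y * h (x - y)"
    by (intro AE_I2 tendsto_mult tendsto_const lim)
  show "(\<lambda>y. k y * h (x - y)) \<in> borel_measurable lborel" by measurable
  show "(\<lambda>y. k y * H n (X n - y)) \<in> borel_measurable lborel" for n by measurable
qed

lemma continuous_on_convolve:
  fixes F :: "real \<Rightarrow> real \<Rightarrow> real"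
  assumes k: "k \<in> borel_measurable borel" "\<And>x. \<bar>k x\<bar> \<le> helmholtz_kernel x"
    and F: "continuous_on (S \<times> UNIV) (\<lambda>(t, x). F t x)" and bd: "\<And>t x. t \<in> S \<Longrightarrow> \<bar>F t x\<bar> \<le> M"
  shows "continuous_on (S \<times> UNIV) (\<lambda>(t, x). convolve k (F t) x)"
proof (rule continuous_on_sequentiallyI)
  fix X :: "nat \<Rightarrow> real \<times> real" and z
  assume X: "\<forall>n. X n \<in> S \<times> UNIV" "z \<in> S \<times> UNIV" "X \<longlonglongrightarrow> z"
  have meas: "F t \<in> borel_measurable borel" if "t \<in> S" for t
    by (intro borel_measurable_continuous_onI continuous_on_compose2[OF F, of UNIV "\<lambda>x. (t, x)", simplified] continuous_intros)
      (use that in auto)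
  have "(\<lambda>n. convolve k (F (fst (X n))) (snd (X n))) \<longlonglongrightarrow> convolve k (F (fst z)) (snd z)"
  proof (rule tendsto_convolve[OF k])
    show "F (fst (X n)) \<in> borel_measurable borel" "\<bar>F (fst (X n)) x\<bar> \<le> M" for n x
      using X(1) by (auto intro!: meas bd simp: mem_Times_iff)
    show "F (fst z) \<in> borel_measurable borel"
      using X(2) by (auto intro!: meas simp: mem_Times_iff)
    fix y
    have "(\<lambda>n. (\<lambda>(t, x). F t x) (fst (X n), snd (X n) - y)) \<longlonglongrightarrow> (\<lambda>(t, x). F t x) (fst z, snd z - y)"
    proof (rule continuous_on_tendsto_compose[OF F])
      show "(\<lambda>n. (fst (X n), snd (X n) - y)) \<longlonglongrightarrow> (fst z, snd z - y)"
        by (intro tendsto_intros X(3))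
    qed (use X in \<open>auto simp: mem_Times_iff\<close>)
    then show "(\<lambda>n. F (fst (X n)) (snd (X n) - y)) \<longlonglongrightarrow> F (fst z) (snd z - y)"
      by simp
  qed
  then show "(\<lambda>n. case X n of (t, x) \<Rightarrow> convolve k (F t) x) \<longlonglongrightarrow> (case z of (t, x) \<Rightarrow> convolve k (F t) x)"
    by (simp add: case_prod_unfold)
qed

section \<open>Derivatives of the convolutions with p and p'\<close>

lemma has_real_derivative_integral_atMost:
  fixes k :: "real \<Rightarrow> real"
  assumes ck: "continuous_on UNIV k" and int: "\<And>x. integrable lborel (\<lambda>y. indicator {..x} y * k y)"
  shows "((\<lambda>x. LINT y|lborel. indicator {..x} y * k y) has_real_derivative k x) (at x)"
proof -
  obtain G where G: "\<And>x. (G has_vector_derivative k x) (at x)"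
    using einterval_antiderivative[of "-\<infinity>" "\<infinity>" k] ck by (auto simp: continuous_on_eq_continuous_at)
  have "(G has_real_derivative k x) (at x)"
    using G by (simp add: has_real_derivative_iff_has_vector_derivative)
  \<comment> \<open>Cutting at \<open>x - 1\<close> makes the improper part constant for all upper
    limits in the neighbourhood \<open>{x-1<..}\<close> of \<open>x\<close>; the rest is an
    antiderivative.\<close>
  then have "((\<lambda>z. (LINT y|lborel. indicator {..x-1} y * k y) + (G z - G (x - 1))) has_real_derivative k x) (at x)"
    by (auto intro!: derivative_eq_intros)
  then show ?thesis
  proof (rule has_field_derivative_transform_within_open[of _ _ _ "{x-1<..}"])
    fix z assume "z \<in> {x-1<..}"
    then have "x - 1 \<le> z" by simp
    have FTC: "has_bochner_integral lborel (\<lambda>y. indicator {x-1..z} y *\<^sub>R k y) (G z - G (x - 1))"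
      by (rule has_bochner_integral_FTC_Icc[OF \<open>x - 1 \<le> z\<close>])
        (use G ck in \<open>auto intro: has_vector_derivative_at_within continuous_on_subset\<close>)
    have "(LINT y|lborel. indicator {..z} y * k y)
       = (LINT y|lborel. indicator {..x-1} y * k y + indicator {x-1..z} y *\<^sub>R k y)"
    proof (rule integral_cong_AE)
      \<comment> \<open>The point \<open>x - 1\<close> lies in both pieces and has to be left
        out.\<close>
      show "AE y in lborel. indicator {..z} y * k y = indicator {..x-1} y * k y + indicator {x-1..z} y *\<^sub>R k y"
        by (rule eventually_mono[OF AE_lborel_singleton[of "x - 1"]])
          (use \<open>x - 1 \<le> z\<close> in \<open>auto simp: indicator_def\<close>)
    qed (use borel_measurable_continuous_onI[OF ck] in simp_all)
    also have "\<dots> = (LINT y|lborel. indicator {..x-1} y * k y) + (G z - G (x - 1))"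
      using int FTC by (simp add: has_bochner_integral_iff)
    finally show "(LINT y|lborel. indicator {..x-1} y * k y) + (G z - G (x - 1)) = (LINT y|lborel. indicator {..z} y * k y)" ..
  qed auto
qed

text \<open>With \<open>a = left_part h\<close> and \<open>b\<close> its mirror image, splitting the kernel at its kink gives \<open>p \<star> h = (a + b) / 2\<close> and \<open>p' \<star> h = (b - a) / 2\<close>,
  where \<open>a' = h - a\<close> and \<open>b' = b - h\<close>.\<close>

definition left_part :: "(real \<Rightarrow> real) \<Rightarrow> real \<Rightarrow> real" where
  "left_part h x = exp (- x) * (LINT y|lborel. indicator {..x} y * (exp y * h y))"

context
  fixes h :: "real \<Rightarrow> real" and M
  assumes ch: "continuous_on UNIV h" and bh: "\<And>x. \<bar>h x\<bar> \<le> M"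
begin

lemma integrable_left_part: "integrable lborel (\<lambda>y. indicator {..x} y * (exp y * h y))"
proof (rule Bochner_Integration.integrable_bound)
  have [measurable]: "h \<in> borel_measurable borel"
    using ch by (rule borel_measurable_continuous_onI)
  show "(\<lambda>y. indicator {..x} y * (exp y * h y)) \<in> borel_measurable lborel" by measurable
  have "integrable lborel (\<lambda>y. helmholtz_kernel (- x + 1 * y))"
    by (intro lborel_integrable_real_affine integrable_helmholtz_kernel) simp
  then show "integrable lborel (\<lambda>y. 2 * exp x * M * helmholtz_kernel (- x + 1 * y))"
    by (rule integrable_mult_right)
  show "AE y in lborel. norm (indicator {..x} y * (exp y * h y)) \<le> norm (2 * exp x * M * helmholtz_kernel (- x + 1 * y))"
  proof (rule AE_I2)
    fix y
    show "norm (indicator {..x} y * (exp y * h y)) \<le> norm (2 * exp x * M * helmholtz_kernel (- x + 1 * y))"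
    proof (cases "y \<le> x")
      case True
      have "2 * exp x * M * helmholtz_kernel (- x + 1 * y) = exp y * M"
        using True by (simp add: helmholtz_kernel_def flip: exp_add)
      moreover have "exp y * \<bar>h y\<bar> \<le> \<bar>exp y * M\<bar>"
        using bh by (simp add: abs_mult) (metis abs_ge_self order_trans)
      ultimately show ?thesis
        using True by (simp only:) (simp add: abs_mult)
    qed simp
  qed
qed

lemma has_real_derivative_left_part:
  "(left_part h has_real_derivative h x - left_part h x) (at x)"
proof -
  have "((\<lambda>x. LINT y|lborel. indicator {..x} y * (exp y * h y)) has_real_derivative exp x * h x) (at x)"
    by (intro has_real_derivative_integral_atMost integrable_left_part continuous_intros ch)
  then have "((\<lambda>x. exp (- x) * (LINT y|lborel. indicator {..x} y * (exp y * h y))) has_real_derivative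
      - exp (- x) * (LINT y|lborel. indicator {..x} y * (exp y * h y)) + exp (- x) * (exp x * h x)) (at x)"
    by (auto intro!: derivative_eq_intros)
  moreover have "exp (- x) * (exp x * h x) = h x"
    by (simp add: exp_minus)
  ultimately show ?thesis
    unfolding left_part_def[abs_def] by simp
qed

end

context
  fixes h :: "real \<Rightarrow> real" and M
  assumes ch: "continuous_on UNIV h" and bh: "\<And>x. \<bar>h x\<bar> \<le> M"
begin

lemma convolve_left_part:
  shows "convolve helmholtz_kernel h x = (left_part h x + left_part (\<lambda>y. h (- y)) (- x)) / 2"
    and "dx_inv_helmholtz h x = (left_part (\<lambda>y. h (- y)) (- x) - left_part h x) / 2"
proof -
  have [measurable]: "h \<in> borel_measurable borel"
    using ch by (rule borel_measurable_continuous_onI)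
  have ch': "continuous_on UNIV (\<lambda>y. h (- y))"
    by (intro continuous_on_compose2[OF ch] continuous_intros) auto
  define A where "A y = exp (- x) / 2 * (indicator {..x} y * (exp y * h y))" for y
  \<comment> \<open>The argument \<open>- y\<close> appears as \<open>0 + (-1) * y\<close>, the form
    in which the affine change of variables is stated.\<close>
  define B where "B y = exp x / 2 * (indicator {..-x} (0 + (-1) * y) * (exp (0 + (-1) * y) * h (- (0 + (-1) * y))))" for y
  have [measurable]: "A \<in> borel_measurable borel" "B \<in> borel_measurable borel"
    unfolding A_def[abs_def] B_def[abs_def] by measurable
  have A: "integrable lborel A" "(LINT y|lborel. A y) = left_part h x / 2"
    unfolding A_def using integrable_left_part[OF ch bh] by (auto simp: left_part_def)
  have intB: "integrable lborel (\<lambda>y. indicator {..-x} y * (exp y * h (- y)))"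
    by (rule integrable_left_part[OF ch' bh])
  have "integrable lborel (\<lambda>y. indicator {..-x} (0 + (-1) * y) * (exp (0 + (-1) * y) * h (- (0 + (-1) * y))))"
    by (rule lborel_integrable_real_affine[OF intB]) simp
  then have B: "integrable lborel B"
    unfolding B_def by (rule integrable_mult_right)
  have "(LINT y|lborel. indicator {..-x} y * (exp y * h (- y))) = \<bar>-1\<bar> *\<^sub>R
    (LINT y|lborel. indicator {..-x} (0 + (-1) * y) * (exp (0 + (-1) * y) * h (- (0 + (-1) * y))))"
    by (rule lborel_integral_real_affine) simp
  then have B2: "(LINT y|lborel. B y) = left_part (\<lambda>y. h (- y)) (- x) / 2"
    unfolding B_def by (simp add: left_part_def)
  have "convolve helmholtz_kernel h x = (LINT y|lborel. A y + B y)"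
    unfolding convolve_def
  proof (rule integral_cong_AE)
    \<comment> \<open>At \<open>y = x\<close> both halves contribute, so the identity is claimed off
      this point only.\<close>
    show "AE y in lborel. helmholtz_kernel (x - y) * h y = A y + B y"
      using AE_lborel_singleton[of x]
      by eventually_elim (auto simp: A_def B_def indicator_def helmholtz_kernel_def abs_if simp flip: exp_add)
  qed simp_all
  then show "convolve helmholtz_kernel h x = (left_part h x + left_part (\<lambda>y. h (- y)) (- x)) / 2"
    using A B B2 by simp
  have "dx_inv_helmholtz h x = (LINT y|lborel. B y - A y)"
    unfolding convolve_def dx_inv_helmholtz_def
  proof (rule integral_cong_AE)
    show "AE y in lborel. dx_helmholtz_kernel (x - y) * h y = B y - A y"
      using AE_lborel_singleton[of x]
      by eventually_elim (auto simp: A_def B_def indicator_def helmholtz_kernel_def dx_helmholtz_kernel_def abs_if simp flip: exp_add)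
  qed simp_all
  then show "dx_inv_helmholtz h x = (left_part (\<lambda>y. h (- y)) (- x) - left_part h x) / 2"
    using A B B2 by simp
qed

lemma has_real_derivative_left_part_reflect:
  "((\<lambda>x. left_part (\<lambda>y. h (- y)) (- x)) has_real_derivative left_part (\<lambda>y. h (- y)) (- x) - h x) (at x)"
proof -
  have ch': "continuous_on UNIV (\<lambda>y. h (- y))"
    by (intro continuous_on_compose2[OF ch] continuous_intros) auto
  have "(left_part (\<lambda>y. h (- y)) has_real_derivative (h (- (- x)) - left_part (\<lambda>y. h (- y)) (- x))) (at (- x))"
    by (rule has_real_derivative_left_part[OF ch' bh])
  then have "((\<lambda>x. left_part (\<lambda>y. h (- y)) (- x)) has_real_derivative (h (- (- x)) - left_part (\<lambda>y. h (- y)) (- x)) * (- 1)) (at x)"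
    by (rule DERIV_chain2) (auto intro!: derivative_eq_intros)
  then show ?thesis by simp
qed

lemma has_real_derivative_inv_helmholtz:
  "(convolve helmholtz_kernel h has_real_derivative dx_inv_helmholtz h x) (at x)"
proof -
  have "((\<lambda>x. (left_part h x + left_part (\<lambda>y. h (- y)) (- x)) / 2) has_real_derivative
    ((h x - left_part h x) + (left_part (\<lambda>y. h (- y)) (- x) - h x)) / 2) (at x)"
    by (intro DERIV_cdivide DERIV_add has_real_derivative_left_part[OF ch bh] has_real_derivative_left_part_reflect)
  then show ?thesis
    unfolding convolve_left_part(1)[abs_def] convolve_left_part(2) by simp
qed

text \<open>The derivatives of \<open>left_part h\<close> and of its mirror image contain
  \<open>h\<close> with opposite signs: it cancels in the half sum p * h, but adds up in the half
  difference p' * h. This is the jump of p' at 0.\<close>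

lemma has_real_derivative_dx_inv_helmholtz:
  "(dx_inv_helmholtz h has_real_derivative convolve helmholtz_kernel h x - h x) (at x)"
proof -
  have "((\<lambda>x. (left_part (\<lambda>y. h (- y)) (- x) - left_part h x) / 2) has_real_derivative
    ((left_part (\<lambda>y. h (- y)) (- x) - h x) - (h x - left_part h x)) / 2) (at x)"
    by (intro DERIV_cdivide DERIV_diff has_real_derivative_left_part[OF ch bh] has_real_derivative_left_part_reflect)
  moreover have "((left_part (\<lambda>y. h (- y)) (- x) - h x) - (h x - left_part h x)) / 2 = convolve helmholtz_kernel h x - h x"
    unfolding convolve_left_part(1) by (simp add: field_simps)
  ultimately show ?thesis
    unfolding convolve_left_part(2)[abs_def] by (simp only:)
qed

text \<open>The kernel is positive everywhere, so \<open>w\<close> is continuous and nonnegative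
  with integral 0 and has to vanish. Restriction to a compact interval around \<open>y\<close>
  reduces this to the case of a bounded domain.\<close>

lemma convolve_helmholtz_kernel_eq_0:
  assumes nn: "\<And>x. h x \<ge> 0" and 0: "convolve helmholtz_kernel h x = 0"
  shows "h y = 0"
proof -
  define w where "w y = helmholtz_kernel (x - y) * h y" for y
  have [measurable]: "h \<in> borel_measurable borel"
    using ch by (rule borel_measurable_continuous_onI)
  have w0: "0 \<le> w y" for y
    unfolding w_def by (intro mult_nonneg_nonneg nn less_imp_le[OF helmholtz_kernel_pos])
  have "continuous_on UNIV w"
    unfolding w_def helmholtz_kernel_def by (intro continuous_intros ch) auto
  have "integrable lborel (\<lambda>y. helmholtz_kernel y * h (x - y))"
    by (rule integrable_kernel_mult[OF _ _ _ bh]) (use helmholtz_kernel_pos in \<open>auto simp: less_imp_le\<close>)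
  then have "integrable lborel (\<lambda>y. helmholtz_kernel (x + (-1) * y) * h (x - (x + (-1) * y)))"
    by (rule lborel_integrable_real_affine) simp
  then have "integrable lborel w"
    unfolding w_def[abs_def] by simp
  then have "(w has_integral integral\<^sup>L lborel w) UNIV"
    by (rule has_integral_integral_lborel)
  moreover have "integral\<^sup>L lborel w = 0"
    using 0 by (simp only: w_def[abs_def] convolve_def)
  ultimately have w: "(w has_integral 0) UNIV"
    by (simp only:)
  have int: "w integrable_on cbox (y - 1) (y + 1)"
    by (rule integrable_continuous) (rule continuous_on_subset[OF \<open>continuous_on UNIV w\<close> subset_UNIV])
  have "integral (cbox (y - 1) (y + 1)) w \<le> integral UNIV w"
    by (rule integral_subset_le[OF subset_UNIV int has_integral_integrable[OF w] ballI[OF w0]])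
  moreover have "0 \<le> integral (cbox (y - 1) (y + 1)) w"
    by (rule Henstock_Kurzweil_Integration.integral_nonneg[OF int w0])
  ultimately have "integral (cbox (y - 1) (y + 1)) w = 0"
    unfolding integral_unique[OF w] by linarith
  then have "(w has_integral 0) (cbox (y - 1) (y + 1))"
    using integrable_integral[OF int] by (simp only:)
  then have "w y = 0"
    by (rule has_integral_0_cbox_imp_0[OF continuous_on_subset[OF \<open>continuous_on UNIV w\<close> subset_UNIV] w0])
      (auto simp: box_real)
  then show ?thesis
    using helmholtz_kernel_pos[of "x - y"] by (simp add: w_def)
qed

lemma tendsto_convolve_at_top:
  assumes "(h \<longlongrightarrow> 0) at_top"
  shows "(\<lambda>n. convolve helmholtz_kernel h (real n)) \<longlonglongrightarrow> 0"
proof -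
  have [measurable]: "h \<in> borel_measurable borel"
    using ch by (rule borel_measurable_continuous_onI)
  have "(\<lambda>n. LINT y|lborel. helmholtz_kernel y * h (real n - y)) \<longlonglongrightarrow> (LINT y::real|lborel. 0)"
  proof (rule integral_dominated_convergence)
    show "integrable lborel (\<lambda>y. helmholtz_kernel y * M)"
      by (intro integrable_mult_left integrable_helmholtz_kernel)
    show "AE y in lborel. norm (helmholtz_kernel y * h (real n - y)) \<le> helmholtz_kernel y * M" for n
      using helmholtz_kernel_pos bh by (auto simp: abs_mult less_imp_le)
    have "(\<lambda>n. h (real n - y)) \<longlonglongrightarrow> 0" for y
      by (rule filterlim_compose[OF assms]) real_asymp
    then show "AE y in lborel. (\<lambda>n. helmholtz_kernel y * h (real n - y)) \<longlonglongrightarrow> 0"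
      by (intro AE_I2 tendsto_mult_right_zero)
  qed simp_all
  then show ?thesis
    by (simp add: convolve_reflect)
qed

end

section \<open>Uniqueness of the zero solution\<close>

text \<open>At a positive maximum of \<open>E t * w t x - \<epsilon> * \<psi> x\<close> the weighted
  space derivative of \<open>w\<close> is at most \<open>\<epsilon>\<close> in size, so the
  transport term costs at most \<open>A * \<epsilon>\<close>, while the weight in time forces
  \<open>l * w t x \<le> \<bar>wt t x\<bar>\<close>. The hypothesis bounds only the size of
  \<open>wt\<close>, which suits both time directions and both signs of \<open>w\<close>.\<close>

lemma max_principle:
  fixes w wt wx :: "real \<Rightarrow> real \<Rightarrow> real"
  assumes cont: "continuous_on ({0..T} \<times> UNIV) (\<lambda>(t, x). w t x)"
    and bd: "\<And>t x. t \<in> {0..T} \<Longrightarrow> w t x \<le> B"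
    and t0: "t0 \<in> {0..T}" and init: "\<And>x. w t0 x \<le> 0"
    and dt: "\<And>t x. t \<in> {0..T} \<Longrightarrow> ((\<lambda>\<tau>. w \<tau> x) has_real_derivative wt t x) (at t within {0..T})"
    and dx: "\<And>t x. t \<in> {0..T} \<Longrightarrow> (w t has_real_derivative wx t x) (at x)"
    and le: "\<And>t x. t \<in> {0..T} \<Longrightarrow> \<bar>wt t x\<bar> \<le> K * exp (l * \<bar>t - t0\<bar>) + A * \<bar>wx t x\<bar>"
    and pos: "l > 0" "A \<ge> 0" "K \<ge> 0" and t: "t \<in> {0..T}"
  shows "w t x \<le> K / l * exp (l * \<bar>t - t0\<bar>)"
proof -
  define E where "E t = exp (- l * \<bar>t - t0\<bar>)" for t
  have E: "0 < E t" "E t \<le> 1" "E t * exp (l * \<bar>t - t0\<bar>) = 1" for t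
    using pos(1) by (auto simp: E_def simp flip: exp_add)
  \<comment> \<open>A smooth substitute for the absolute value: unbounded, but with slope at most
    1.\<close>
  define \<psi> :: "real \<Rightarrow> real" where "\<psi> x = sqrt (1 + x\<^sup>2)" for x
  have \<psi>pos: "1 + x\<^sup>2 > 0" for x :: real
    by (simp add: add_pos_nonneg)
  have \<psi>: "\<psi> x \<ge> \<bar>x\<bar>" "\<psi> x \<ge> 1" for x
    unfolding \<psi>_def by (auto intro!: real_le_rsqrt)
  have d\<psi>: "(\<psi> has_real_derivative x / \<psi> x) (at x)" for x
    unfolding \<psi>_def using \<psi>pos[of x] by (auto intro!: derivative_eq_intros simp: field_simps)
  have d\<psi>_le: "\<bar>x / \<psi> x\<bar> \<le> 1" for x
    using \<psi>[of x] by (simp add: abs_divide divide_le_eq)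
  have key: "E t * w t x - \<epsilon> * \<psi> x \<le> (K + A * \<epsilon>) / l" if "\<epsilon> > 0" for \<epsilon>
  proof -
    define z where "z t x = E t * w t x - \<epsilon> * \<psi> x" for t x
    \<comment> \<open>Beyond \<open>\<bar>B\<bar> / \<epsilon>\<close> the penalty outweighs
      \<open>w\<close>, so a positive maximum over the box is global; \<open>\<bar>x\<bar>\<close>
      brings the given point into the box.\<close>
    define R where "R = max \<bar>x\<bar> (\<bar>B\<bar> / \<epsilon>)"
    have "continuous_on ({0..T} \<times> {-R..R}) (\<lambda>p. w (fst p) (snd p))"
      using continuous_on_subset[OF cont, of "{0..T} \<times> {-R..R}"] by (auto simp: case_prod_unfold)
    then have "continuous_on ({0..T} \<times> {-R..R}) (\<lambda>p. z (fst p) (snd p))"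
      unfolding z_def E_def \<psi>_def by (intro continuous_intros)
    moreover have "compact ({0..T} \<times> {-R..R})" "(t, x) \<in> {0..T} \<times> {-R..R}"
      using t by (auto simp: R_def compact_Times abs_le_iff le_max_iff_disj intro: order_trans[of "-R"])
    ultimately obtain p where p: "p \<in> {0..T} \<times> {-R..R}"
      "\<And>q. q \<in> {0..T} \<times> {-R..R} \<Longrightarrow> z (fst q) (snd q) \<le> z (fst p) (snd p)"
      using continuous_attains_sup[of "{0..T} \<times> {-R..R}" "\<lambda>p. z (fst p) (snd p)"] by blast
    obtain t1 x1 where p_eq: "p = (t1, x1)" by (cases p)
    have t1: "t1 \<in> {0..T}" using p by (simp add: p_eq)
    have zx: "z t x \<le> z t1 x1"
      using p(2)[of "(t, x)"] \<open>(t, x) \<in> _\<close> by (simp add: p_eq)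
    show ?thesis
    proof (cases "z t1 x1 \<le> 0")
      case True
      have "0 \<le> (K + A * \<epsilon>) / l"
        using pos \<open>\<epsilon> > 0\<close> by simp
      then show ?thesis
        using True zx by (simp add: z_def)
    next
      case False
      have max: "z s y \<le> z t1 x1" if s: "s \<in> {0..T}" for s y
      proof (cases "y \<in> {-R..R}")
        case True
        then show ?thesis
          using p(2)[of "(s, y)"] s by (simp add: p_eq)
      next
        case False
        then have "\<bar>B\<bar> / \<epsilon> < \<bar>y\<bar>"
          by (auto simp: R_def)
        then have "\<bar>B\<bar> < \<epsilon> * \<bar>y\<bar>"
          using \<open>\<epsilon> > 0\<close> by (simp add: divide_less_eq mult.commute)
        also have "\<dots> \<le> \<epsilon> * \<psi> y"
          using \<psi> \<open>\<epsilon> > 0\<close> by simp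
        finally have 1: "\<bar>B\<bar> < \<epsilon> * \<psi> y" .
        have "E s * w s y \<le> E s * \<bar>B\<bar>"
          using bd[OF s, of y] E(1)[of s] by simp
        also have "\<dots> \<le> 1 * \<bar>B\<bar>"
          using E by (intro mult_right_mono) auto
        finally have "z s y < 0"
          using 1 by (simp add: z_def)
        then show ?thesis
          using \<open>\<not> z t1 x1 \<le> 0\<close> by simp
      qed
      have "(z t1 has_real_derivative E t1 * wx t1 x1 - \<epsilon> * (x1 / \<psi> x1)) (at x1)"
        unfolding z_def by (intro DERIV_diff DERIV_cmult dx d\<psi> t1)
      then have "E t1 * wx t1 x1 - \<epsilon> * (x1 / \<psi> x1) = 0"
        by (rule DERIV_local_max[of _ _ _ 1]) (use max[OF t1] in auto)
      then have "E t1 * \<bar>wx t1 x1\<bar> = \<epsilon> * \<bar>x1 / \<psi> x1\<bar>"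
        using E(1)[of t1] \<open>\<epsilon> > 0\<close> by (metis abs_mult abs_of_pos eq_iff_diff_eq_0)
      also have "\<dots> \<le> \<epsilon> * 1"
        using d\<psi>_le \<open>\<epsilon> > 0\<close> by (intro mult_left_mono) auto
      finally have Ewx: "E t1 * \<bar>wx t1 x1\<bar> \<le> \<epsilon>" by simp
      have maxt: "E s * w s x1 \<le> E t1 * w t1 x1" if "s \<in> {0..T}" for s
        using max[OF that, of x1] by (simp add: z_def)
      \<comment> \<open>The weight has a kink at \<open>t0\<close>. There the initial condition
        makes \<open>z\<close> negative, so in both remaining cases the weight is smooth between
        \<open>t0\<close> and \<open>t1\<close>.\<close>
      have "t1 \<noteq> t0"
      proof
        assume "t1 = t0"
        then have "E t1 * w t1 x1 \<le> 0"
          using init[of x1] E(1)[of t1] by (simp add: mult_nonneg_nonpos)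
        then show False
          using False \<open>\<epsilon> > 0\<close> \<psi>(2)[of x1] by (simp add: z_def) (smt (verit) mult_pos_pos)
      qed
      \<comment> \<open>The maximum is compared with times between \<open>t1\<close> and
        \<open>t0\<close>. These are available even if \<open>t1\<close> is an end of the time
        interval, and the one-sided derivative in this direction has the useful sign.\<close>
      have "l * w t1 x1 \<le> \<bar>wt t1 x1\<bar>"
      proof (cases "t0 < t1")
        case True
        have "((\<lambda>s. exp (- l * (s - t0)) * w s x1) has_real_derivative
            exp (- l * (t1 - t0)) * (wt t1 x1 - l * w t1 x1)) (at t1 within {0..T})"
          by (rule derivative_eq_intros dt[OF t1] refl | simp add: algebra_simps)+
        then have D: "((\<lambda>s. exp (- l * (s - t0)) * w s x1) has_real_derivative
            exp (- l * (t1 - t0)) * (wt t1 x1 - l * w t1 x1)) (at t1 within {t0..t1})"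
          by (rule DERIV_subset) (use t0 t1 in auto)
        have "\<not> exp (- l * (t1 - t0)) * (wt t1 x1 - l * w t1 x1) < 0"
        proof
          assume "exp (- l * (t1 - t0)) * (wt t1 x1 - l * w t1 x1) < 0"
          then obtain d where "d > 0" and d: "\<And>h. h > 0 \<Longrightarrow> t1 - h \<in> {t0..t1} \<Longrightarrow> h < d \<Longrightarrow>
             exp (- l * (t1 - t0)) * w t1 x1 < exp (- l * (t1 - h - t0)) * w (t1 - h) x1"
            using has_real_derivative_neg_dec_left[OF D] by blast
          define h where "h = min (d / 2) (t1 - t0)"
          have h: "h > 0" "t1 - h \<in> {t0..t1}" "h < d"
            using \<open>d > 0\<close> True by (auto simp: h_def min_def)
          have "t1 - h \<in> {0..T}"
            using h t0 t1 by auto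
          from maxt[OF this] d[OF h] show False
            using h True by (simp add: E_def)
        qed
        then show ?thesis
          by (simp add: mult_less_0_iff)
      next
        case False
        then have "t1 < t0" using \<open>t1 \<noteq> t0\<close> by simp
        have "((\<lambda>s. exp (l * (s - t0)) * w s x1) has_real_derivative
            exp (l * (t1 - t0)) * (wt t1 x1 + l * w t1 x1)) (at t1 within {0..T})"
          by (rule derivative_eq_intros dt[OF t1] refl | simp add: algebra_simps)+
        then have D: "((\<lambda>s. exp (l * (s - t0)) * w s x1) has_real_derivative
            exp (l * (t1 - t0)) * (wt t1 x1 + l * w t1 x1)) (at t1 within {t1..t0})"
          by (rule DERIV_subset) (use t0 t1 in auto)
        have "\<not> exp (l * (t1 - t0)) * (wt t1 x1 + l * w t1 x1) > 0"
        proof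
          assume "exp (l * (t1 - t0)) * (wt t1 x1 + l * w t1 x1) > 0"
          then obtain d where "d > 0" and d: "\<And>h. h > 0 \<Longrightarrow> t1 + h \<in> {t1..t0} \<Longrightarrow> h < d \<Longrightarrow>
             exp (l * (t1 - t0)) * w t1 x1 < exp (l * (t1 + h - t0)) * w (t1 + h) x1"
            using has_real_derivative_pos_inc_right[OF D] by blast
          define h where "h = min (d / 2) (t0 - t1)"
          have h: "h > 0" "t1 + h \<in> {t1..t0}" "h < d"
            using \<open>d > 0\<close> \<open>t1 < t0\<close> by (auto simp: h_def min_def)
          have "t1 + h \<in> {0..T}"
            using h t0 t1 by auto
          moreover have "E s = exp (l * (s - t0))" if "s \<le> t0" for s
            using that by (simp add: E_def abs_if algebra_simps)
          ultimately show False
            using maxt[of "t1 + h"] d[OF h] h \<open>t1 < t0\<close> by simp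
        qed
        then show ?thesis
          by (simp add: zero_less_mult_iff)
      qed
      also have "\<dots> \<le> K * exp (l * \<bar>t1 - t0\<bar>) + A * \<bar>wx t1 x1\<bar>"
        by (rule le[OF t1])
      finally have "E t1 * (l * w t1 x1) \<le> E t1 * (K * exp (l * \<bar>t1 - t0\<bar>) + A * \<bar>wx t1 x1\<bar>)"
        using E(1)[of t1] by simp
      also have "\<dots> = K * (E t1 * exp (l * \<bar>t1 - t0\<bar>)) + A * (E t1 * \<bar>wx t1 x1\<bar>)"
        by (simp add: algebra_simps)
      also have "\<dots> \<le> K + A * \<epsilon>"
        unfolding E using Ewx pos by (auto intro: mult_left_mono)
      finally have "E t1 * w t1 x1 \<le> (K + A * \<epsilon>) / l"
        using pos by (simp add: le_divide_eq algebra_simps)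
      moreover have "\<epsilon> * \<psi> x1 \<ge> 0"
        using \<open>\<epsilon> > 0\<close> \<psi>(2)[of x1] by simp
      ultimately show ?thesis
        using zx by (simp add: z_def)
    qed
  qed
  have "E t * w t x \<le> K / l"
  proof (rule field_le_epsilon)
    fix e :: real assume "e > 0"
    \<comment> \<open>Makes the two errors in \<open>key\<close>, namely
      \<open>A * \<epsilon> / l\<close> and \<open>\<epsilon> * \<psi> x\<close>, add up to
      \<open>e\<close>.\<close>
    define \<epsilon> where "\<epsilon> = e / (A / l + \<psi> x)"
    have "A / l + \<psi> x > 0"
      using pos \<psi>(2)[of x] by (intro add_nonneg_pos) auto
    then have "\<epsilon> > 0" "\<epsilon> * (A / l + \<psi> x) = e"
      using \<open>e > 0\<close> by (auto simp: \<epsilon>_def)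
    then show "E t * w t x \<le> K / l + e"
      using key[of \<epsilon>] by (simp add: algebra_simps add_divide_distrib)
  qed
  then have "E t * w t x * exp (l * \<bar>t - t0\<bar>) \<le> K / l * exp (l * \<bar>t - t0\<bar>)"
    by (rule mult_right_mono) simp
  moreover have "E t * w t x * exp (l * \<bar>t - t0\<bar>) = w t x * (E t * exp (l * \<bar>t - t0\<bar>))"
    by (simp add: mult_ac)
  ultimately show ?thesis
    by (simp add: E(3))
qed

corollary max_principle_abs:
  fixes w wt wx :: "real \<Rightarrow> real \<Rightarrow> real"
  assumes cont: "continuous_on ({0..T} \<times> UNIV) (\<lambda>(t, x). w t x)"
    and bd: "\<And>t x. t \<in> {0..T} \<Longrightarrow> \<bar>w t x\<bar> \<le> B"
    and t0: "t0 \<in> {0..T}" and init: "\<And>x. w t0 x = 0"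
    and dt: "\<And>t x. t \<in> {0..T} \<Longrightarrow> ((\<lambda>\<tau>. w \<tau> x) has_real_derivative wt t x) (at t within {0..T})"
    and dx: "\<And>t x. t \<in> {0..T} \<Longrightarrow> (w t has_real_derivative wx t x) (at x)"
    and le: "\<And>t x. t \<in> {0..T} \<Longrightarrow> \<bar>wt t x\<bar> \<le> K * exp (l * \<bar>t - t0\<bar>) + A * \<bar>wx t x\<bar>"
    and pos: "l > 0" "A \<ge> 0" "K \<ge> 0" and t: "t \<in> {0..T}"
  shows "\<bar>w t x\<bar> \<le> K / l * exp (l * \<bar>t - t0\<bar>)"
proof -
  have "w t x \<le> K / l * exp (l * \<bar>t - t0\<bar>)"
    by (rule max_principle[OF cont _ t0 _ dt dx le pos t, of B]) (use bd init in \<open>auto simp: abs_le_iff\<close>)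
  moreover have "- w t x \<le> K / l * exp (l * \<bar>t - t0\<bar>)"
  proof (rule max_principle[OF _ _ t0 _ DERIV_minus[OF dt] DERIV_minus[OF dx] _ pos t])
    show "continuous_on ({0..T} \<times> UNIV) (\<lambda>(t, x). - w t x)"
      using continuous_on_minus[OF cont] by (simp add: case_prod_unfold)
    show "- w t x \<le> B" if "t \<in> {0..T}" for t x
      using bd[OF that, of x] by simp
  qed (use init le in simp_all)
  ultimately show ?thesis by simp
qed

section \<open>Bounded C^1 solutions vanishing at one time\<close>

locale bounded_solution =
  fixes f g :: "real \<Rightarrow> real" and T B :: real and u :: "real \<Rightarrow> real \<Rightarrow> real"
  assumes smooth_f: "smooth f" and smooth_g: "smooth g" and g0: "g 0 = 0"
    and solution: "solves f g T u"
    and cont_u: "continuous_on ({0..T} \<times> UNIV) (\<lambda>(t, x). u t x)"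
    and cont_ux: "continuous_on ({0..T} \<times> UNIV) (\<lambda>(t, x). deriv (u t) x)"
    and bound_u: "\<And>t x. t \<in> {0..T} \<Longrightarrow> \<bar>u t x\<bar> \<le> B"
    and bound_ux: "\<And>t x. t \<in> {0..T} \<Longrightarrow> \<bar>deriv (u t) x\<bar> \<le> B"
begin

text \<open>This is F of the overview.\<close>

definition source :: "real \<Rightarrow> real \<Rightarrow> real" where
  "source t y = g (u t y) + deriv (deriv f) (u t y) / 2 * (deriv (u t) y)\<^sup>2"

text \<open>The equation solved for the time derivative. \<open>solves\<close> merely provides some
  derivative at each point, whereas continuity in time and space jointly can be read off from this
  expression.\<close>

definition u_t :: "real \<Rightarrow> real \<Rightarrow> real" where
  "u_t t x = - (deriv f (u t x) * deriv (u t) x + dx_inv_helmholtz (source t) x)"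

lemma DERIV_f:
  "(f has_real_derivative deriv f y) (at y)"
  "(deriv f has_real_derivative deriv (deriv f) y) (at y)"
  "continuous_on UNIV (deriv (deriv f))"
proof -
  have "((deriv ^^ n) f has_real_derivative deriv ((deriv ^^ n) f) y) (at y)" for n y
    using smooth_f unfolding smooth_def differentiable_on_def
    by (simp add: DERIV_deriv_iff_real_differentiable)
  from this[of 0] this[of 1] this[of 2]
  show "(f has_real_derivative deriv f y) (at y)"
    "(deriv f has_real_derivative deriv (deriv f) y) (at y)"
    "continuous_on UNIV (deriv (deriv f))"
    by (auto simp: numeral_2_eq_2 intro!: DERIV_continuous_on[of _ _ "\<lambda>x. deriv (deriv (deriv f)) x"])
qed

lemma DERIV_g: "(g has_real_derivative deriv g y) (at y)" "continuous_on UNIV (deriv g)"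
proof -
  have "((deriv ^^ n) g has_real_derivative deriv ((deriv ^^ n) g) y) (at y)" for n y
    using smooth_g unfolding smooth_def differentiable_on_def
    by (simp add: DERIV_deriv_iff_real_differentiable)
  from this[of 0] this[of 1]
  show "(g has_real_derivative deriv g y) (at y)" "continuous_on UNIV (deriv g)"
    by (auto intro!: DERIV_continuous_on[of _ _ "\<lambda>x. deriv (deriv g) x"])
qed

lemma cont_fg: "continuous_on UNIV f" "continuous_on UNIV (deriv f)" "continuous_on UNIV g"
  using DERIV_f DERIV_g by (auto intro!: DERIV_continuous_on)

lemma DERIV_u:
  assumes "t \<in> {0..T}"
  shows "((\<lambda>\<tau>. u \<tau> x) has_real_derivative u_t t x) (at t within {0..T})"
    and "(u t has_real_derivative deriv (u t) x) (at x)"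
proof -
  obtain ut ux where *: "((\<lambda>\<tau>. u \<tau> x) has_real_derivative ut) (at t within {0..T})"
    "(u t has_real_derivative ux) (at x)"
    "ut + deriv f (u t x) * ux + dx_inv_helmholtz (source t) x = 0"
    using solution assms unfolding solves_def source_def[abs_def] by blast
  have "deriv (u t) x = ux"
    by (rule DERIV_imp_deriv[OF *(2)])
  then show "((\<lambda>\<tau>. u \<tau> x) has_real_derivative u_t t x) (at t within {0..T})"
    "(u t has_real_derivative deriv (u t) x) (at x)"
    using * unfolding u_t_def by (auto simp: minus_equation_iff eq_neg_iff_add_eq_0 intro: back_subst[of "\<lambda>z. (_ has_real_derivative z) _"])
qed

lemma continuous_on_source: "continuous_on ({0..T} \<times> UNIV) (\<lambda>(t, x). source t x)"
proof -
  have c: "continuous_on ({0..T} \<times> UNIV) (\<lambda>p. u (fst p) (snd p))"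
    "continuous_on ({0..T} \<times> UNIV) (\<lambda>p. deriv (u (fst p)) (snd p))"
    using cont_u cont_ux by (auto simp: case_prod_unfold)
  show ?thesis
    unfolding source_def case_prod_unfold
    by (intro continuous_intros c continuous_on_compose2[OF cont_fg(3)] continuous_on_compose2[OF DERIV_f(3)] subset_UNIV) simp
qed

lemma continuous_source: "t \<in> {0..T} \<Longrightarrow> continuous_on UNIV (source t)"
  using continuous_on_compose2[OF continuous_on_source, of UNIV "\<lambda>x. (t, x)"]
  by (simp add: continuous_on_Pair image_subset_iff)

lemma bounded_on_range:
  assumes "continuous_on UNIV (k :: real \<Rightarrow> real)"
  obtains C where "C \<ge> 0" "\<And>y. \<bar>y\<bar> \<le> B \<Longrightarrow> \<bar>k y\<bar> \<le> C"
proof -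
  have "compact (k ` {-B..B})"
    by (intro compact_continuous_image continuous_on_subset[OF assms]) auto
  then obtain C where C: "\<forall>y\<in>k ` {-B..B}. norm y \<le> C"
    using compact_imp_bounded bounded_iff by metis
  show ?thesis
  proof (rule that[of "max 0 C"])
    show "\<bar>k y\<bar> \<le> max 0 C" if "\<bar>y\<bar> \<le> B" for y
      using C that by (auto simp: le_max_iff_disj abs_le_iff)
  qed simp
qed

lemma lipschitz_on_range:
  assumes k: "\<And>y. (k has_real_derivative k' y) (at y)" and C: "\<And>y. \<bar>y\<bar> \<le> B \<Longrightarrow> \<bar>k' y\<bar> \<le> C"
    and "\<bar>y\<bar> \<le> B" "\<bar>z\<bar> \<le> B"
  shows "\<bar>k y - k z\<bar> \<le> C * \<bar>y - z\<bar>"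
proof -
  have "norm (k y - k z) \<le> C * norm (y - z)"
    by (rule field_differentiable_bound[of "{-B..B}" k k'])
      (use assms in \<open>auto intro: has_field_derivative_at_within\<close>)
  then show ?thesis by simp
qed

lemma B_nonneg: "t \<in> {0..T} \<Longrightarrow> B \<ge> 0"
  using bound_u[of t 0] by simp

text \<open>Linear in \<open>N\<close> in spite of the square: one factor
  \<open>deriv (u t) x\<close> is estimated by \<open>B\<close>, the other by \<open>N\<close>, and
  \<open>g\<close> is Lipschitz on the range with \<open>g 0 = 0\<close>. That \<open>C\<close> does
  not depend on \<open>N\<close> is what allows the iteration in \<open>zero_unique\<close>.\<close>

lemma source_bound:
  obtains C where "C \<ge> 0"
    "\<And>t x N. t \<in> {0..T} \<Longrightarrow> \<bar>u t x\<bar> \<le> N \<Longrightarrow> \<bar>deriv (u t) x\<bar> \<le> N \<Longrightarrow> \<bar>source t x\<bar> \<le> C * N"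
proof -
  obtain Cg where Cg: "Cg \<ge> 0" "\<And>y. \<bar>y\<bar> \<le> B \<Longrightarrow> \<bar>deriv g y\<bar> \<le> Cg"
    using bounded_on_range[OF DERIV_g(2)] by blast
  obtain Cf where Cf: "Cf \<ge> 0" "\<And>y. \<bar>y\<bar> \<le> B \<Longrightarrow> \<bar>deriv (deriv f) y\<bar> \<le> Cf"
    using bounded_on_range[OF DERIV_f(3)] by blast
  show ?thesis
  proof (rule that[of "Cg + Cf / 2 * \<bar>B\<bar>"])
    show "0 \<le> Cg + Cf / 2 * \<bar>B\<bar>"
      using Cg Cf by simp
    fix t x N assume t: "t \<in> {0..T}" and N: "\<bar>u t x\<bar> \<le> N" "\<bar>deriv (u t) x\<bar> \<le> N"
    note B = bound_u[OF t, of x] bound_ux[OF t, of x] B_nonneg[OF t]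
    have "\<bar>g (u t x) - g 0\<bar> \<le> Cg * \<bar>u t x - 0\<bar>"
      by (rule lipschitz_on_range[OF DERIV_g(1) Cg(2)]) (use B in auto)
    also have "\<dots> \<le> Cg * N"
      using N Cg by (simp add: mult_left_mono)
    finally have 1: "\<bar>g (u t x)\<bar> \<le> Cg * N"
      by (simp add: g0)
    have "\<bar>deriv (deriv f) (u t x) / 2 * (deriv (u t) x)\<^sup>2\<bar>
        = \<bar>deriv (deriv f) (u t x)\<bar> / 2 * (\<bar>deriv (u t) x\<bar> * \<bar>deriv (u t) x\<bar>)"
      by (simp add: abs_mult power2_eq_square)
    also have "\<dots> \<le> Cf / 2 * (\<bar>B\<bar> * N)"
      using B N Cf by (intro mult_mono divide_right_mono) auto
    finally show "\<bar>source t x\<bar> \<le> (Cg + Cf / 2 * \<bar>B\<bar>) * N"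
      using 1 unfolding source_def distrib_right mult.assoc
      by (metis abs_triangle_ineq add_mono order_trans)
  qed
qed

lemma source_bounded: obtains M where "\<And>t x. t \<in> {0..T} \<Longrightarrow> \<bar>source t x\<bar> \<le> M"
  using source_bound bound_u bound_ux by metis

theorem zero_unique:
  assumes t0: "t0 \<in> {0..T}" and zero: "\<And>x. u t0 x = 0" and "t \<in> {0..T}"
  shows "u t x = 0"
proof -
  obtain C1 where C1: "C1 \<ge> 0"
    "\<And>t x N. t \<in> {0..T} \<Longrightarrow> \<bar>u t x\<bar> \<le> N \<Longrightarrow> \<bar>deriv (u t) x\<bar> \<le> N \<Longrightarrow> \<bar>source t x\<bar> \<le> C1 * N"
    using source_bound by metis
  obtain Ca where Ca: "Ca \<ge> 0" "\<And>y. \<bar>y\<bar> \<le> B \<Longrightarrow> \<bar>deriv f y\<bar> \<le> Ca"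
    using bounded_on_range[OF cont_fg(2)] by blast
  obtain Cf where Cf: "Cf \<ge> 0" "\<And>y. \<bar>y\<bar> \<le> B \<Longrightarrow> \<bar>deriv (deriv f) y\<bar> \<le> Cf"
    using bounded_on_range[OF DERIV_f(3)] by blast
  note B = B_nonneg[OF t0]
  define \<kappa> where "\<kappa> = kernel_mass"
  have \<kappa>: "\<kappa> \<ge> 0" unfolding \<kappa>_def by (rule kernel_mass_nonneg)
  \<comment> \<open>Collects the forcing terms. In the equation for \<open>u\<close> it is p' * F,
    of rate \<open>\<kappa> * C1\<close>; for the difference quotients \<open>B * Cf\<close> comes
    from the variation of the speed f'(u), and \<open>(\<kappa> + 1) * C1\<close> from p * F -
    F.\<close>
  define C where "C = B * Cf + (\<kappa> + 1) * C1"
  have C: "0 \<le> C" "\<kappa> * C1 \<le> C"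
    using B Cf C1 \<kappa> by (auto simp: C_def algebra_simps)
  \<comment> \<open>Gives \<open>C / l \<le> 1 / 2\<close>, and is positive even if
    \<open>C = 0\<close>.\<close>
  define l where "l = 2 * C + 1"
  have l: "l > 0" using C by (simp add: l_def)
  define E where "E t = exp (l * \<bar>t - t0\<bar>)" for t
  have E: "E t \<ge> 1" for t using l by (simp add: E_def)
  have step: "\<bar>u t x\<bar> \<le> N / 2 * E t \<and> \<bar>deriv (u t) x\<bar> \<le> N / 2 * E t"
    if "N \<ge> 0" and N: "\<And>t x. t \<in> {0..T} \<Longrightarrow> \<bar>u t x\<bar> \<le> N * E t \<and> \<bar>deriv (u t) x\<bar> \<le> N * E t"
      and t: "t \<in> {0..T}" for N t x
  proof -
    have src: "\<bar>source t x\<bar> \<le> C1 * (N * E t)" if "t \<in> {0..T}" for t x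
      using C1(2)[OF that] N[OF that] by blast
    have meas: "source t \<in> borel_measurable borel" if "t \<in> {0..T}" for t
      by (rule borel_measurable_continuous_onI[OF continuous_source[OF that]])
    have P: "\<bar>convolve helmholtz_kernel (source t) x\<bar> \<le> \<kappa> * (C1 * (N * E t))"
      and Q: "\<bar>dx_inv_helmholtz (source t) x\<bar> \<le> \<kappa> * (C1 * (N * E t))" if "t \<in> {0..T}" for t x
      unfolding \<kappa>_def dx_inv_helmholtz_def
      by (rule abs_convolve_le; use meas[OF that] src[OF that] helmholtz_kernel_pos abs_dx_helmholtz_kernel_le in \<open>simp add: less_imp_le\<close>)+
    have "C * N / l \<le> N / 2"
      using \<open>N \<ge> 0\<close> C by (simp add: l_def divide_le_eq algebra_simps)
    then have CN: "C * N / l * E t \<le> N / 2 * E t" for t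
      using E[of t] by (intro mult_right_mono) auto
    have u_le: "\<bar>u t x\<bar> \<le> C * N / l * exp (l * \<bar>t - t0\<bar>)"
    proof (rule max_principle_abs[OF cont_u bound_u t0 zero DERIV_u _ l Ca(1) _ t])
      show "0 \<le> C * N" using C \<open>N \<ge> 0\<close> by simp
      fix t x assume t: "t \<in> {0..T}"
      have "\<bar>u_t t x\<bar> \<le> \<bar>deriv f (u t x)\<bar> * \<bar>deriv (u t) x\<bar> + \<bar>dx_inv_helmholtz (source t) x\<bar>"
        unfolding u_t_def by (metis abs_minus_cancel abs_mult abs_triangle_ineq)
      also have "\<dots> \<le> Ca * \<bar>deriv (u t) x\<bar> + \<kappa> * (C1 * (N * E t))"
        by (intro add_mono mult_right_mono Ca(2) bound_u[OF t] Q[OF t]) simp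
      also have "\<kappa> * (C1 * (N * E t)) \<le> C * (N * E t)"
        using C(2) \<open>N \<ge> 0\<close> E[of t] by (simp only: mult.assoc[symmetric]) (intro mult_right_mono; simp)
      finally show "\<bar>u_t t x\<bar> \<le> C * N * exp (l * \<bar>t - t0\<bar>) + Ca * \<bar>deriv (u t) x\<bar>"
        by (simp add: E_def mult.assoc)
    qed assumption+
    have quot_le: "\<bar>(u t (x + h) - u t x) / h\<bar> \<le> C * N / l * exp (l * \<bar>t - t0\<bar>)" if "h > 0" for h
    proof -
      define w where "w t x = (u t (x + h) - u t x) / h" for t x
      define wt where "wt t x = (u_t t (x + h) - u_t t x) / h" for t x
      define wx where "wx t x = (deriv (u t) (x + h) - deriv (u t) x) / h" for t x
      have mvt: "\<bar>k (x + h) - k x\<bar> \<le> M * h"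
        if "\<And>y. (k has_real_derivative k' y) (at y)" "\<And>y. \<bar>k' y\<bar> \<le> M" for k k' M x
        using field_differentiable_bound[of UNIV k k' M x "x + h"] that \<open>h > 0\<close> by simp
      have w_le: "\<bar>w t x\<bar> \<le> M" if "t \<in> {0..T}" "\<And>y. \<bar>deriv (u t) y\<bar> \<le> M" for t x M
        using mvt[OF DERIV_u(2)[OF that(1)] that(2), of x] \<open>h > 0\<close> by (simp add: w_def divide_le_eq)
      have "\<bar>w t x\<bar> \<le> C * N / l * exp (l * \<bar>t - t0\<bar>)"
      proof (rule max_principle_abs[where w=w and wt=wt and wx=wx and B=B and A=Ca, OF _ _ t0 _ _ _ _ l Ca(1) _ t])
        show "continuous_on ({0..T} \<times> UNIV) (\<lambda>(t, x). w t x)"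
        proof -
          have "continuous_on ({0..T} \<times> UNIV) (\<lambda>p. u (fst p) (snd p))"
            using cont_u by (simp add: case_prod_unfold)
          moreover have "continuous_on ({0..T} \<times> UNIV) (\<lambda>p. u (fst p) (snd p + h))"
          proof -
            have "continuous_on ({0..T} \<times> UNIV) (\<lambda>p. case (fst p, snd p + h) of (t, x) \<Rightarrow> u t x)"
              by (rule continuous_on_compose2[OF cont_u]) (auto intro!: continuous_intros)
            then show ?thesis by simp
          qed
          ultimately show ?thesis
            unfolding w_def case_prod_unfold using \<open>h > 0\<close> by (intro continuous_intros) auto
        qed
        show "0 \<le> C * N" using C \<open>N \<ge> 0\<close> by simp
        show "w t0 x = 0" for x by (simp add: w_def zero)
        fix t x assume t: "t \<in> {0..T}"
        show "\<bar>w t x\<bar> \<le> B"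
          by (rule w_le[OF t bound_ux[OF t]])
        show "((\<lambda>\<tau>. w \<tau> x) has_real_derivative wt t x) (at t within {0..T})"
          unfolding w_def wt_def by (intro DERIV_cdivide DERIV_diff DERIV_u t)
        show "(w t has_real_derivative wx t x) (at x)"
          unfolding w_def wx_def by (intro DERIV_cdivide DERIV_diff DERIV_u t DERIV_shift[THEN iffD1])
        define Qd where "Qd = (dx_inv_helmholtz (source t) (x + h) - dx_inv_helmholtz (source t) x) / h"
        have "\<bar>Qd\<bar> \<le> (\<kappa> + 1) * (C1 * (N * E t))"
        proof -
          have "\<bar>convolve helmholtz_kernel (source t) y - source t y\<bar> \<le> (\<kappa> + 1) * (C1 * (N * E t))" for y
            using P[OF t, of y] src[OF t, of y] unfolding distrib_right mult_1_left by linarith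
          from mvt[OF has_real_derivative_dx_inv_helmholtz[OF continuous_source[OF t] src[OF t]] this, of x]
          show ?thesis
            using \<open>h > 0\<close> by (simp add: Qd_def divide_le_eq)
        qed
        \<comment> \<open>A discrete product rule. With the speed taken at \<open>x + h\<close> the
          transport term is an exact multiple of \<open>wx\<close>; what remains contains no
          derivative of \<open>u\<close> beyond the first.\<close>
        have w_eq: "wt t x = - (deriv f (u t (x + h)) * wx t x
            + deriv (u t) x * ((deriv f (u t (x + h)) - deriv f (u t x)) / h) + Qd)"
          using \<open>h > 0\<close> by (simp add: wt_def u_t_def wx_def Qd_def field_simps)
        have "\<bar>(deriv f (u t (x + h)) - deriv f (u t x)) / h\<bar> \<le> Cf * \<bar>w t x\<bar>"
          using lipschitz_on_range[OF DERIV_f(2) Cf(2) bound_u[OF t, of "x + h"] bound_u[OF t, of x]] \<open>h > 0\<close>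
          by (simp add: w_def divide_le_cancel)
        \<comment> \<open>By the mean value theorem the quotient \<open>w\<close> inherits the bound
          on \<open>deriv (u t)\<close>, uniformly in \<open>h\<close>.\<close>
        also have "\<dots> \<le> Cf * (N * E t)"
          by (intro mult_left_mono w_le[OF t] Cf(1)) (use N[OF t] in blast)
        finally have q: "\<bar>(deriv f (u t (x + h)) - deriv f (u t x)) / h\<bar> \<le> Cf * (N * E t)" .
        have "\<bar>wt t x\<bar> \<le> \<bar>deriv f (u t (x + h))\<bar> * \<bar>wx t x\<bar>
            + \<bar>deriv (u t) x\<bar> * \<bar>(deriv f (u t (x + h)) - deriv f (u t x)) / h\<bar> + \<bar>Qd\<bar>"
        proof -
          have "\<bar>a + b + c\<bar> \<le> \<bar>a\<bar> + \<bar>b\<bar> + \<bar>c\<bar>" for a b c :: real by linarith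
          then show ?thesis
            unfolding w_eq abs_minus_cancel abs_mult[symmetric] .
        qed
        also have "\<dots> \<le> Ca * \<bar>wx t x\<bar> + B * (Cf * (N * E t)) + (\<kappa> + 1) * (C1 * (N * E t))"
          by (intro add_mono mult_mono Ca bound_u[OF t] bound_ux[OF t] q \<open>\<bar>Qd\<bar> \<le> _\<close> B) simp_all
        also have "\<dots> = C * N * exp (l * \<bar>t - t0\<bar>) + Ca * \<bar>wx t x\<bar>"
          by (simp add: C_def E_def algebra_simps)
        finally show "\<bar>wt t x\<bar> \<le> C * N * exp (l * \<bar>t - t0\<bar>) + Ca * \<bar>wx t x\<bar>" .
      qed
      then show ?thesis by (simp add: w_def)
    qed
    have "((\<lambda>h. (u t (x + h) - u t x) / h) \<longlongrightarrow> deriv (u t) x) (at 0)"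
      using DERIV_u(2)[OF t, of x] by (simp add: DERIV_def)
    then have "((\<lambda>h. (u t (x + h) - u t x) / h) \<longlongrightarrow> deriv (u t) x) (at_right 0)"
      by (rule tendsto_within_subset) simp
    moreover have "eventually (\<lambda>h. \<bar>(u t (x + h) - u t x) / h\<bar> \<le> C * N / l * exp (l * \<bar>t - t0\<bar>)) (at_right 0)"
      unfolding eventually_at_filter by (intro always_eventually allI impI quot_le) simp
    ultimately have "\<bar>deriv (u t) x\<bar> \<le> C * N / l * exp (l * \<bar>t - t0\<bar>)"
      by (intro tendsto_upperbound[OF tendsto_rabs]) auto
    then show ?thesis
      using u_le CN[of t] unfolding E_def by linarith
  qed
  \<comment> \<open>Starts from the a priori bound \<open>B\<close>, since
    \<open>E t \<ge> 1\<close>.\<close>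
  have iter: "\<forall>t\<in>{0..T}. \<forall>x. \<bar>u t x\<bar> \<le> B / 2 ^ n * E t \<and> \<bar>deriv (u t) x\<bar> \<le> B / 2 ^ n * E t" for n
  proof (induction n)
    case 0
    have "B \<le> B * E t" for t
      using mult_left_mono[OF E[of t] B] by simp
    then show ?case
      by (auto intro: order_trans[OF bound_u] order_trans[OF bound_ux])
  next
    case (Suc n)
    have "0 \<le> B / 2 ^ n" using B by simp
    moreover have "B / 2 ^ Suc n = B / 2 ^ n / 2" by simp
    ultimately show ?case
      using step[of "B / 2 ^ n"] Suc by (simp only:) blast
  qed
  have "(\<lambda>n. B / 2 ^ n * E t) \<longlonglongrightarrow> 0 * E t"
    by (intro tendsto_mult tendsto_const) real_asymp
  then have "\<bar>u t x\<bar> \<le> 0 * E t"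
    by (rule tendsto_lowerbound) (use iter \<open>t \<in> {0..T}\<close> in auto)
  then show ?thesis by simp
qed

end

section \<open>Solutions with compact support\<close>

text \<open>If \<open>\<bar>h x\<bar> \<ge> e\<close>, the Lipschitz bound keeps
  \<open>\<bar>h\<bar>\<close> above \<open>e / 2\<close> on an interval of fixed length
  \<open>d\<close> to the right of \<open>x\<close>. This puts at least
  \<open>d * (e / 2)\<^sup>2\<close> into the tail integral from \<open>x\<close> on, but the tails
  tend to 0.\<close>

lemma square_integrable_lipschitz_tendsto_0:
  fixes h :: "real \<Rightarrow> real"
  assumes sh: "square_integrable h" and lip: "\<And>x y. \<bar>h x - h y\<bar> \<le> L * \<bar>x - y\<bar>"
  shows "(h \<longlongrightarrow> 0) at_top"
proof (rule tendstoI)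
  fix e :: real assume e: "e > 0"
  have [measurable]: "h \<in> borel_measurable borel" and int: "integrable lborel (\<lambda>y. (h y)\<^sup>2)"
    using sh by (auto simp: square_integrable_def)
  define I where "I x = (LINT y|lborel. indicator {x..} y * (h y)\<^sup>2)" for x
  have intI: "integrable lborel (\<lambda>y. indicator {x..} y * (h y)\<^sup>2)" for x
    by (rule Bochner_Integration.integrable_bound[OF int]) (auto simp: indicator_def)
  have "(I \<longlongrightarrow> (LINT y::real|lborel. 0)) at_top"
    unfolding I_def
  proof (rule integral_dominated_convergence_at_top[OF _ _ int])
    show "AE y in lborel. ((\<lambda>x. indicator {x..} y * (h y)\<^sup>2) \<longlongrightarrow> 0) at_top"
    proof (rule AE_I2)
      fix y
      show "((\<lambda>x. indicator {x..} y * (h y)\<^sup>2) \<longlongrightarrow> 0) at_top"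
        by (rule tendsto_eventually) (use eventually_gt_at_top[of y] in eventually_elim, simp)
    qed
  qed (auto simp: indicator_def)
  then have I0: "(I \<longlongrightarrow> 0) at_top" by simp
  \<comment> \<open>\<open>L\<close> may be 0, and \<open>d\<close> needs a positive
    denominator.\<close>
  define L' where "L' = \<bar>L\<bar> + 1"
  define d where "d = e / (2 * L')"
  have d: "d > 0" "L' * d = e / 2"
  proof -
    have "L' > 0" by (simp add: L'_def)
    then show "d > 0" "L' * d = e / 2"
      using e by (auto simp: d_def)
  qed
  have small: "\<bar>h x\<bar> < e" if "I x < d * (e / 2)\<^sup>2" for x
  proof (rule ccontr)
    assume "\<not> \<bar>h x\<bar> < e"
    then have hx: "\<bar>h x\<bar> \<ge> e" by simp
    have "(LINT y|lborel. indicator {x..x+d} y * (e / 2)\<^sup>2) \<le> I x"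
      unfolding I_def
    proof (rule integral_mono[OF _ intI])
      show "integrable lborel (\<lambda>y. indicator {x..x+d} y * (e / 2)\<^sup>2)"
        using d by (intro integrable_mult_left integrable_real_indicator) auto
      fix y
      show "indicator {x..x+d} y * (e / 2)\<^sup>2 \<le> indicator {x..} y * (h y)\<^sup>2"
      proof (cases "y \<in> {x..x+d}")
        case True
        have "\<bar>h x - h y\<bar> \<le> \<bar>L\<bar> * \<bar>x - y\<bar>"
          using lip[of x y] by (meson abs_ge_self abs_ge_zero mult_right_mono order_trans)
        also have "\<dots> \<le> L' * d"
          using True by (intro mult_mono) (auto simp: L'_def)
        finally have "e / 2 \<le> \<bar>h y\<bar>"
          using hx d by linarith
        then have "(e / 2)\<^sup>2 \<le> \<bar>h y\<bar>\<^sup>2"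
          using e by (intro power_mono) auto
        then show ?thesis using True by simp
      qed (auto simp: indicator_def)
    qed
    moreover have "(LINT y|lborel. indicator {x..x+d} y * (e / 2)\<^sup>2) = d * (e / 2)\<^sup>2"
      using d by simp
    ultimately show False using that by linarith
  qed
  have "eventually (\<lambda>x. I x < d * (e / 2)\<^sup>2) at_top"
    using d e by (intro order_tendstoD(2)[OF I0]) simp
  then show "eventually (\<lambda>x. dist (h x) 0 < e) at_top"
    by eventually_elim (simp add: small)
qed

text \<open>By uniform continuity and the mean value theorem, \<open>h'\<close> differs by less than
  \<open>e / 2\<close> from the difference quotient of \<open>h\<close> over a fixed step
  \<open>d\<close>; these quotients tend to 0 with \<open>h\<close>.\<close>

lemma barbalat:
  fixes h h' :: "real \<Rightarrow> real"
  assumes h: "(h \<longlongrightarrow> 0) at_top" and h': "\<And>x. (h has_real_derivative h' x) (at x)"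
    and uc: "uniformly_continuous_on UNIV h'"
  shows "(h' \<longlongrightarrow> 0) at_top"
proof (rule tendstoI)
  fix e :: real assume e: "e > 0"
  then obtain d0 where d0: "d0 > 0" "\<And>x y. \<bar>y - x\<bar> < d0 \<Longrightarrow> \<bar>h' y - h' x\<bar> < e / 2"
    using uc unfolding uniformly_continuous_on_def dist_real_def by (metis UNIV_I half_gt_zero)
  define d where "d = d0 / 2"
  have d: "d > 0" "d < d0" using d0 by (auto simp: d_def)
  have "((\<lambda>x. (h (x + d) - h x) / d) \<longlongrightarrow> (0 - 0) / d) at_top"
    using d by (intro tendsto_intros h filterlim_compose[OF h] filterlim_tendsto_add_at_top[OF tendsto_const filterlim_ident, of d, unfolded add.commute[of d]]) auto
  then have "eventually (\<lambda>x. \<bar>(h (x + d) - h x) / d\<bar> < e / 2) at_top"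
    using e order_tendstoD(2)[OF tendsto_rabs, of "\<lambda>x. (h (x + d) - h x) / d" 0 at_top "e / 2"] by simp
  then show "eventually (\<lambda>x. dist (h' x) 0 < e) at_top"
  proof eventually_elim
    fix x assume *: "\<bar>(h (x + d) - h x) / d\<bar> < e / 2"
    obtain z where z: "x < z" "z < x + d" "h (x + d) - h x = (x + d - x) * h' z"
      using MVT2[of x "x + d" h h'] d h' by auto
    then have "(h (x + d) - h x) / d = h' z"
      using d by simp
    moreover have "\<bar>h' x - h' z\<bar> < e / 2"
      using z d by (intro d0) auto
    ultimately have "\<bar>h' x\<bar> < e"
      using * by linarith
    then show "dist (h' x) 0 < e" by simp
  qed
qed

text \<open>A convex function lies above its tangents, and the tangent at 0 is the zero
  function.\<close>

lemma convex_nonneg: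
  fixes f :: "real \<Rightarrow> real"
  assumes f: "\<And>x. (f has_real_derivative f' x) (at x)" "\<And>x. (f' has_real_derivative f'' x) (at x)"
    and "\<And>x. f'' x \<ge> 0" "f 0 = 0" "f' 0 = 0"
  shows "f x \<ge> 0"
proof -
  have "convex_on UNIV f"
    by (rule f''_ge0_imp_convex[OF convex_UNIV]) (use assms in auto)
  from convex_on_imp_above_tangent[OF this, of 0 x "f' 0"] show ?thesis
    using f(1)[of 0] assms by simp
qed

section \<open>The flux argument between two times of compact support\<close>

context bounded_solution
begin

lemma compactly_supported_vanish:
  assumes f: "f 0 = 0" "deriv f 0 = 0" "\<And>x. deriv (deriv f) x \<ge> 0"
    and g: "\<And>x. g x \<ge> 0" "\<And>x. g x = 0 \<longleftrightarrow> x = 0"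
    and decay: "\<And>t. t \<in> {0..T} \<Longrightarrow> (u t \<longlongrightarrow> 0) at_top" "\<And>t. t \<in> {0..T} \<Longrightarrow> (deriv (u t) \<longlongrightarrow> 0) at_top"
    and t: "t0 \<in> {0..T}" "t1 \<in> {0..T}" "t0 < t1"
    and supp: "\<And>x. x \<ge> R \<Longrightarrow> u t0 x = 0" "\<And>x. x \<ge> R \<Longrightarrow> u t1 x = 0"
  shows "u t0 x = 0"
proof -
  have sub: "{t0..t1} \<subseteq> {0..T}" using t by auto
  obtain M where M: "\<And>t x. t \<in> {0..T} \<Longrightarrow> \<bar>source t x\<bar> \<le> M"
    using source_bounded by blast
  have source_nonneg: "source t x \<ge> 0" for t x
    unfolding source_def using f g by simp
  \<comment> \<open>The flux at a single time; the H of the overview is its integral over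
    \<open>{t0..t1}\<close>.\<close>
  define H where "H t x = f (u t x) + convolve helmholtz_kernel (source t) x" for t x
  have f_nonneg: "f y \<ge> 0" for y
    by (rule convex_nonneg[OF DERIV_f(1,2) f(3,1,2)])
  have conv_nonneg: "convolve helmholtz_kernel (source t) x \<ge> 0" for t x
    unfolding convolve_def
    by (intro Bochner_Integration.integral_nonneg mult_nonneg_nonneg source_nonneg less_imp_le[OF helmholtz_kernel_pos])
  have contP: "continuous_on ({0..T} \<times> UNIV) (\<lambda>(t, x). convolve helmholtz_kernel (source t) x)"
    by (rule continuous_on_convolve[OF _ _ continuous_on_source M]) (use helmholtz_kernel_pos in \<open>auto simp: less_imp_le\<close>)
  have contQ: "continuous_on ({0..T} \<times> UNIV) (\<lambda>(t, x). dx_inv_helmholtz (source t) x)"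
    unfolding dx_inv_helmholtz_def
    by (rule continuous_on_convolve[OF _ _ continuous_on_source M]) (auto simp: abs_dx_helmholtz_kernel_le)
  have c: "continuous_on ({0..T} \<times> UNIV) (\<lambda>p. u (fst p) (snd p))"
    "continuous_on ({0..T} \<times> UNIV) (\<lambda>p. deriv (u (fst p)) (snd p))"
    "continuous_on ({0..T} \<times> UNIV) (\<lambda>p. convolve helmholtz_kernel (source (fst p)) (snd p))"
    "continuous_on ({0..T} \<times> UNIV) (\<lambda>p. dx_inv_helmholtz (source (fst p)) (snd p))"
    using cont_u cont_ux contP contQ by (auto simp: case_prod_unfold)
  have contH: "continuous_on ({0..T} \<times> UNIV) (\<lambda>p. H (fst p) (snd p))"
    unfolding H_def by (intro continuous_intros c continuous_on_compose2[OF cont_fg(1)] subset_UNIV)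
  have contut: "continuous_on ({0..T} \<times> UNIV) (\<lambda>p. u_t (fst p) (snd p))"
    unfolding u_t_def by (intro continuous_intros c continuous_on_compose2[OF cont_fg(2)] subset_UNIV)
  have contHt: "continuous_on {t0..t1} (\<lambda>t. H t x)" for x
  proof -
    have "continuous_on {t0..t1} (\<lambda>t. H (fst (t, x)) (snd (t, x)))"
      by (rule continuous_on_compose2[OF contH]) (use sub in \<open>auto intro!: continuous_intros\<close>)
    then show ?thesis by simp
  qed
  have contu: "continuous_on UNIV (u t)" if "t \<in> {0..T}" for t
    using DERIV_u(2)[OF that] by (rule DERIV_continuous_on)
  have dH: "(H t has_real_derivative - u_t t x) (at x)" if "t \<in> {0..T}" for t x
    unfolding H_def u_t_def minus_minus
    by (intro DERIV_add DERIV_chain2[OF DERIV_f(1)] DERIV_u(2) that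
      has_real_derivative_inv_helmholtz[OF continuous_source[OF that] M[OF that]])
  have flux: "integral {t0..t1} (\<lambda>t. H t b) = integral {t0..t1} (\<lambda>t. H t a)" if "R \<le> a" "a \<le> b" for a b
  proof -
    \<comment> \<open>The mass in \<open>[a, b]\<close> changes at the rate of the flux difference:
      differentiation under the integral, then the fundamental theorem in space, because the space
      derivative of \<open>H t\<close> is \<open>- u_t t\<close>.\<close>
    have d\<Phi>: "((\<lambda>t. integral (cbox a b) (u t)) has_real_derivative - (H t b - H t a)) (at t within {t0..t1})"
      if t: "t \<in> {t0..t1}" for t
    proof -
      have tT: "t \<in> {0..T}" using t sub by auto
      have "((\<lambda>t. integral (cbox a b) (u t)) has_field_derivative integral (cbox a b) (u_t t)) (at t within {t0..t1})"
      proof (rule leibniz_rule_field_derivative)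
        show "((\<lambda>t. u t x) has_field_derivative u_t s x) (at s within {t0..t1})"
          if "s \<in> {t0..t1}" for s x
          by (rule DERIV_subset[OF DERIV_u(1) sub]) (use that sub in auto)
        show "u s integrable_on cbox a b" if "s \<in> {t0..t1}" for s
          using that sub by (intro integrable_continuous continuous_on_subset[OF contu subset_UNIV]) auto
        show "continuous_on ({t0..t1} \<times> cbox a b) (\<lambda>(s, x). u_t s x)"
          unfolding case_prod_unfold by (rule continuous_on_subset[OF contut]) (use sub in auto)
      qed (use t in auto)
      moreover have "(u_t t has_integral (- H t b - - H t a)) {a..b}"
        by (rule fundamental_theorem_of_calculus[OF \<open>a \<le> b\<close>])
          (use DERIV_minus[OF dH[OF tT]] in \<open>auto intro: has_field_derivative_at_within simp flip: has_real_derivative_iff_has_vector_derivative\<close>)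
      ultimately show ?thesis
        by (simp add: integral_unique)
    qed
    have "((\<lambda>t. - (H t b - H t a)) has_integral (integral (cbox a b) (u t1) - integral (cbox a b) (u t0))) {t0..t1}"
      by (rule fundamental_theorem_of_calculus)
        (use t d\<Phi> in \<open>auto simp flip: has_real_derivative_iff_has_vector_derivative\<close>)
    moreover have "integral (cbox a b) (u s) = 0" if "s \<in> {t0, t1}" for s
    proof -
      have "integral (cbox a b) (u s) = integral (cbox a b) (\<lambda>x. 0)"
        by (rule Henstock_Kurzweil_Integration.integral_cong) (use that supp \<open>R \<le> a\<close> in auto)
      then show ?thesis by simp
    qed
    ultimately have "((\<lambda>t. - (H t b - H t a)) has_integral 0) {t0..t1}"
      by simp
    then have "integral {t0..t1} (\<lambda>t. H t a - H t b) = 0"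
      by (simp add: integral_unique)
    then show ?thesis
      by (subst (asm) Henstock_Kurzweil_Integration.integral_diff)
        (auto intro: integrable_continuous_interval contHt)
  qed
  obtain C where C: "\<And>y. \<bar>y\<bar> \<le> B \<Longrightarrow> \<bar>f y\<bar> \<le> C"
    using bounded_on_range[OF cont_fg(1)] by blast
  \<comment> \<open>The flux at each single time tends to 0 at infinity; its uniform bound in time
    and space allows the limit under the time integral.\<close>
  have lim: "(\<lambda>n. integral {t0..t1} (\<lambda>t. H t (real n))) \<longlonglongrightarrow> integral {t0..t1} (\<lambda>t. 0)"
  proof (rule dominated_convergence(2))
    show "(\<lambda>t. H t (real n)) integrable_on {t0..t1}" for n
      by (intro integrable_continuous_interval contHt)
    show "(\<lambda>t. C + kernel_mass * M) integrable_on {t0..t1}"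
      by (rule integrable_const_ivl)
    fix s assume "s \<in> {t0..t1}"
    then have s: "s \<in> {0..T}" using sub by auto
    have meas: "source s \<in> borel_measurable borel"
      by (rule borel_measurable_continuous_onI[OF continuous_source[OF s]])
    have "\<bar>convolve helmholtz_kernel (source s) y\<bar> \<le> kernel_mass * M" for y
      by (rule abs_convolve_le) (use meas M[OF s] helmholtz_kernel_pos in \<open>auto simp: less_imp_le\<close>)
    then show "norm (H s (real n)) \<le> C + kernel_mass * M" for n
      unfolding H_def real_norm_def using C[OF bound_u[OF s]] by (meson abs_triangle_ineq add_mono order_trans)
    \<comment> \<open>F involves the space derivative, hence the decay of \<open>deriv (u s)\<close>
      enters besides that of \<open>u s\<close>.\<close>
    have "(source s \<longlongrightarrow> g 0 + deriv (deriv f) 0 / 2 * 0\<^sup>2) at_top"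
      unfolding source_def using cont_fg(3) DERIV_f(3)
      by (intro tendsto_intros isCont_tendsto_compose[OF _ decay(1)[OF s]] decay(2)[OF s])
        (auto simp: continuous_on_eq_continuous_at)
    then have "(\<lambda>n. convolve helmholtz_kernel (source s) (real n)) \<longlonglongrightarrow> 0"
      by (intro tendsto_convolve_at_top[OF continuous_source[OF s] M[OF s]]) (simp add: g0)
    moreover have "(\<lambda>n. f (u s (real n))) \<longlonglongrightarrow> f 0"
      using cont_fg(1) by (intro isCont_tendsto_compose[OF _ filterlim_compose[OF decay(1)[OF s] filterlim_real_sequentially]])
        (auto simp: continuous_on_eq_continuous_at)
    ultimately have "(\<lambda>n. H s (real n)) \<longlonglongrightarrow> f 0 + 0"
      unfolding H_def by (intro tendsto_add)
    then show "(\<lambda>n. H s (real n)) \<longlonglongrightarrow> 0"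
      by (simp add: f(1))
  qed
  have "eventually (\<lambda>n. integral {t0..t1} (\<lambda>t. H t (real n)) = integral {t0..t1} (\<lambda>t. H t R)) sequentially"
    using eventually_ge_at_top[of "nat \<lceil>R\<rceil>"]
    by eventually_elim (rule flux, auto)
  then have "(\<lambda>n. integral {t0..t1} (\<lambda>t. H t (real n))) \<longlonglongrightarrow> integral {t0..t1} (\<lambda>t. H t R)"
    by (rule tendsto_eventually)
  from LIMSEQ_unique[OF this lim] have "integral {t0..t1} (\<lambda>t. H t R) = 0"
    by simp
  then have "((\<lambda>t. H t R) has_integral 0) (cbox t0 t1)"
    using integrable_integral[OF integrable_continuous_interval[OF contHt[of R]]] by (simp add: box_real)
  \<comment> \<open>A continuous nonnegative function with integral 0 over a nondegenerate interval
    vanishes at every point of it, including the end \<open>t0\<close>.\<close>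
  then have "H t0 R = 0"
    by (rule has_integral_0_cbox_imp_0[rotated 2])
      (use contHt t f_nonneg conv_nonneg in \<open>auto simp: H_def box_real\<close>)
  then have "convolve helmholtz_kernel (source t0) R = 0"
    using f_nonneg[of "u t0 R"] conv_nonneg[of t0 R] by (simp add: H_def)
  then have "source t0 x = 0"
    by (rule convolve_helmholtz_kernel_eq_0[OF continuous_source[OF t(1)] M[OF t(1)] source_nonneg])
  moreover have "0 \<le> deriv (deriv f) (u t0 x) / 2 * (deriv (u t0) x)\<^sup>2"
    using f(3) by simp
  ultimately have "g (u t0 x) = 0"
    using g(1)[of "u t0 x"] unfolding source_def by linarith
  then show ?thesis
    using g(2) by simp
qed

end

section \<open>From H^s to bounded C^1 solutions\<close>

lemma sup_continuous_family:
  fixes \<phi> :: "real \<Rightarrow> real \<Rightarrow> real"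
  assumes c: "\<And>t. t \<in> {0..T} \<Longrightarrow> continuous_on UNIV (\<phi> t)"
    and b: "\<And>t. t \<in> {0..T} \<Longrightarrow> \<exists>M. \<forall>x. \<bar>\<phi> t x\<bar> \<le> M"
    and u: "\<And>t e. t \<in> {0..T} \<Longrightarrow> e > 0 \<Longrightarrow> \<exists>d>0. \<forall>\<tau>\<in>{0..T}. \<bar>\<tau> - t\<bar> < d \<longrightarrow> (\<forall>x. \<bar>\<phi> \<tau> x - \<phi> t x\<bar> < e)"
  shows "continuous_on ({0..T} \<times> UNIV) (\<lambda>(t, x). \<phi> t x)"
    and "\<exists>M. \<forall>t\<in>{0..T}. \<forall>x. \<bar>\<phi> t x\<bar> \<le> M"
proof -
  show "continuous_on ({0..T} \<times> UNIV) (\<lambda>(t, x). \<phi> t x)"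
    unfolding continuous_on_iff
  proof (intro ballI allI impI)
    fix q :: "real \<times> real" and e :: real assume q: "q \<in> {0..T} \<times> UNIV" and e: "e > 0"
    obtain t x where [simp]: "q = (t, x)" by (cases q)
    have t: "t \<in> {0..T}" using q by simp
    obtain d1 where d1: "d1 > 0" "\<And>\<tau> y. \<tau> \<in> {0..T} \<Longrightarrow> \<bar>\<tau> - t\<bar> < d1 \<Longrightarrow> \<bar>\<phi> \<tau> y - \<phi> t y\<bar> < e / 2"
      using u[OF t, of "e / 2"] e by auto
    obtain d2 where d2: "d2 > 0" "\<And>y. dist y x < d2 \<Longrightarrow> dist (\<phi> t y) (\<phi> t x) < e / 2"
      using c[OF t] e unfolding continuous_on_iff by (metis UNIV_I half_gt_zero)
    show "\<exists>d>0. \<forall>p\<in>{0..T} \<times> UNIV. dist p q < d \<longrightarrow>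
        dist (case p of (t, x) \<Rightarrow> \<phi> t x) (case q of (t, x) \<Rightarrow> \<phi> t x) < e"
    proof (intro exI[of _ "min d1 d2"] conjI ballI impI)
      fix p assume p: "p \<in> {0..T} \<times> (UNIV :: real set)" "dist p q < min d1 d2"
      obtain \<tau> y where [simp]: "p = (\<tau>, y)" by (cases p)
      have "dist \<tau> t < d1" "dist y x < d2"
        using p(2) dist_fst_le[of p "(t, x)"] dist_snd_le[of p "(t, x)"] by auto
      then have "\<bar>\<phi> \<tau> y - \<phi> t y\<bar> < e / 2" "\<bar>\<phi> t y - \<phi> t x\<bar> < e / 2"
        using d1(2)[of \<tau> y] d2(2)[of y] p(1) by (auto simp: dist_real_def)
      then have "\<bar>\<phi> \<tau> y - \<phi> t x\<bar> < e" by linarith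
      then show "dist (case p of (t, x) \<Rightarrow> \<phi> t x) (case q of (t, x) \<Rightarrow> \<phi> t x) < e"
        by (simp add: dist_real_def)
    qed (use d1 d2 in simp)
  qed
  show "\<exists>M. \<forall>t\<in>{0..T}. \<forall>x. \<bar>\<phi> t x\<bar> \<le> M"
  proof -
    \<comment> \<open>A bound near each time; compactness of the time interval then reduces to
      finitely many of them.\<close>
    have "\<exists>d M. d > 0 \<and> (\<forall>\<tau>\<in>{0..T}. \<bar>\<tau> - t\<bar> < d \<longrightarrow> (\<forall>x. \<bar>\<phi> \<tau> x\<bar> \<le> M))" if t: "t \<in> {0..T}" for t
    proof -
      obtain d where d: "d > 0" "\<And>\<tau> x. \<tau> \<in> {0..T} \<Longrightarrow> \<bar>\<tau> - t\<bar> < d \<Longrightarrow> \<bar>\<phi> \<tau> x - \<phi> t x\<bar> < 1"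
        using u[OF t, of 1] by auto
      obtain M where M: "\<And>x. \<bar>\<phi> t x\<bar> \<le> M"
        using b[OF t] by auto
      have "\<bar>\<phi> \<tau> x\<bar> \<le> M + 1" if "\<tau> \<in> {0..T}" "\<bar>\<tau> - t\<bar> < d" for \<tau> x
        using d(2)[OF that, of x] M[of x] by linarith
      then show ?thesis using d(1) by blast
    qed
    then obtain d where "\<And>t. t \<in> {0..T} \<Longrightarrow>
        \<exists>M. d t > 0 \<and> (\<forall>\<tau>\<in>{0..T}. \<bar>\<tau> - t\<bar> < d t \<longrightarrow> (\<forall>x. \<bar>\<phi> \<tau> x\<bar> \<le> M))"
      by metis
    then obtain M where dM: "\<And>t. t \<in> {0..T} \<Longrightarrow>
        d t > 0 \<and> (\<forall>\<tau>\<in>{0..T}. \<bar>\<tau> - t\<bar> < d t \<longrightarrow> (\<forall>x. \<bar>\<phi> \<tau> x\<bar> \<le> M t))"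
      by metis
    have "{0..T} \<subseteq> (\<Union>t\<in>{0..T}. ball t (d t))"
      using dM by (intro subsetI UN_I) auto
    from compactE_image[OF compact_Icc open_ball this]
    obtain D where D: "D \<subseteq> {0..T}" "finite D" "{0..T} \<subseteq> (\<Union>t\<in>D. ball t (d t))" .
    \<comment> \<open>A sum of absolute values instead of a maximum, so that an empty
      \<open>D\<close> is no exception.\<close>
    have "\<bar>\<phi> \<tau> x\<bar> \<le> (\<Sum>t\<in>D. \<bar>M t\<bar>)" if \<tau>: "\<tau> \<in> {0..T}" for \<tau> x
    proof -
      obtain t where t: "t \<in> D" "\<tau> \<in> ball t (d t)"
        using D(3) \<tau> by blast
      then have "t \<in> {0..T}" "\<bar>\<tau> - t\<bar> < d t"
        using D(1) by (auto simp: dist_real_def)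
      then have "\<bar>\<phi> \<tau> x\<bar> \<le> M t"
        using dM \<tau> by blast
      also have "\<dots> \<le> \<bar>M t\<bar>" by simp
      also have "\<dots> \<le> (\<Sum>t\<in>D. \<bar>M t\<bar>)"
        by (rule member_le_sum[OF t(1)]) (use D in auto)
      finally show ?thesis .
    qed
    then show ?thesis by blast
  qed
qed

text \<open>The passage from Sobolev spaces to classical analysis: afterwards only continuity, the
  common bound on \<open>u\<close> and its space derivative, and their decay at infinity are
  used.\<close>

lemma bounded_solutionI:
  assumes smooth: "smooth f" "smooth g" "g 0 = 0" and "s > 3 / 2"
    and cs: "continuous_sobolev s T u" and sol: "solves f g T u"
  obtains B where "bounded_solution f g T B u"
    "\<And>t. t \<in> {0..T} \<Longrightarrow> (u t \<longlongrightarrow> 0) at_top" "\<And>t. t \<in> {0..T} \<Longrightarrow> (deriv (u t) \<longlongrightarrow> 0) at_top"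
proof -
  obtain K where K: "K \<ge> 0"
    "\<And>h x. \<lbrakk>h \<in> sobolev s; \<And>x. h differentiable at x\<rbrakk> \<Longrightarrow> \<bar>h x\<bar> \<le> K * sobolev_norm s h"
    "\<And>h x. \<lbrakk>h \<in> sobolev s; \<And>x. h differentiable at x\<rbrakk> \<Longrightarrow> \<bar>deriv h x\<bar> \<le> K * sobolev_norm s h"
    "\<And>h. \<lbrakk>h \<in> sobolev s; \<And>x. h differentiable at x\<rbrakk> \<Longrightarrow> uniformly_continuous_on UNIV (deriv h)"
    using sobolev_embedding[OF \<open>s > 3 / 2\<close>] by metis
  have us: "u t \<in> sobolev s" if "t \<in> {0..T}" for t
    using cs that by (simp add: continuous_sobolev_def)
  have diff: "u t differentiable at x" if "t \<in> {0..T}" for t x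
    using sol that unfolding solves_def by (meson real_differentiable_def)
  have D: "(u t has_real_derivative deriv (u t) x) (at x)" if "t \<in> {0..T}" for t x
    using diff[OF that] by (simp add: DERIV_deriv_iff_real_differentiable)
  have uc: "uniformly_continuous_on UNIV (deriv (u t))" if "t \<in> {0..T}" for t
    by (rule K(4)[OF us[OF that] diff[OF that]])
  \<comment> \<open>The embedding is applied to the difference of two time slices, which is again
    differentiable and in H^s. Continuity in the Sobolev norm thereby becomes continuity in the sup
    norm of both \<open>u\<close> and its space derivative.\<close>
  have close: "\<exists>d>0. \<forall>\<tau>\<in>{0..T}. \<bar>\<tau> - t\<bar> < d \<longrightarrow>
      (\<forall>x. \<bar>u \<tau> x - u t x\<bar> < e \<and> \<bar>deriv (u \<tau>) x - deriv (u t) x\<bar> < e)"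
    if t: "t \<in> {0..T}" and "e > 0" for t e
  proof -
    define N where "N \<tau> = sobolev_norm s (\<lambda>x. u \<tau> x - u t x)" for \<tau>
    have "(N \<longlongrightarrow> 0) (at t within {0..T})"
      using cs t unfolding continuous_sobolev_def N_def by blast
    then have "((\<lambda>\<tau>. K * N \<tau>) \<longlongrightarrow> 0) (at t within {0..T})"
      by (rule tendsto_mult_right_zero)
    then have "eventually (\<lambda>\<tau>. K * N \<tau> < e) (at t within {0..T})"
      using \<open>e > 0\<close> by (rule order_tendstoD(2))
    then obtain d where d: "d > 0" "\<And>\<tau>. \<tau> \<in> {0..T} \<Longrightarrow> \<tau> \<noteq> t \<Longrightarrow> \<bar>\<tau> - t\<bar> < d \<Longrightarrow> K * N \<tau> < e"
      unfolding eventually_at dist_real_def by blast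
    have "\<bar>u \<tau> x - u t x\<bar> < e \<and> \<bar>deriv (u \<tau>) x - deriv (u t) x\<bar> < e"
      if \<tau>: "\<tau> \<in> {0..T}" "\<bar>\<tau> - t\<bar> < d" for \<tau> x
    \<comment> \<open>The limit of \<open>N\<close> concerns only times different from
      \<open>t\<close>.\<close>
    proof (cases "\<tau> = t")
      case False
      have s: "(\<lambda>x. u \<tau> x - u t x) \<in> sobolev s"
        by (rule sobolev_diff[OF us[OF \<tau>(1)] us[OF t]])
      have dd: "((\<lambda>x. u \<tau> x - u t x) has_real_derivative deriv (u \<tau>) x - deriv (u t) x) (at x)" for x
        by (intro DERIV_diff D \<tau>(1) t)
      then have df: "(\<lambda>x. u \<tau> x - u t x) differentiable at x" for x
        using real_differentiable_def by blast
      show ?thesis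
        using K(2)[OF s df, of x] K(3)[OF s df, of x] d(2)[OF \<tau>(1) False \<tau>(2)]
        unfolding N_def DERIV_imp_deriv[OF dd] by linarith
    qed (use \<open>e > 0\<close> in simp)
    then show ?thesis using d(1) by blast
  qed
  have contu: "continuous_on UNIV (u t)" if "t \<in> {0..T}" for t
    using D[OF that] by (rule DERIV_continuous_on)
  have b1: "\<exists>M. \<forall>x. \<bar>u t x\<bar> \<le> M" and b2: "\<exists>M. \<forall>x. \<bar>deriv (u t) x\<bar> \<le> M" if "t \<in> {0..T}" for t
    by (rule exI, rule allI, rule K(2)[OF us[OF that] diff[OF that]])
      (rule exI, rule allI, rule K(3)[OF us[OF that] diff[OF that]])
  have c1: "\<exists>d>0. \<forall>\<tau>\<in>{0..T}. \<bar>\<tau> - t\<bar> < d \<longrightarrow> (\<forall>x. \<bar>u \<tau> x - u t x\<bar> < e)"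
    and c2: "\<exists>d>0. \<forall>\<tau>\<in>{0..T}. \<bar>\<tau> - t\<bar> < d \<longrightarrow> (\<forall>x. \<bar>deriv (u \<tau>) x - deriv (u t) x\<bar> < e)"
    if "t \<in> {0..T}" "e > 0" for t e
    using close[OF that] by fast+
  have u1: "continuous_on ({0..T} \<times> UNIV) (\<lambda>(t, x). u t x)" "\<exists>M. \<forall>t\<in>{0..T}. \<forall>x. \<bar>u t x\<bar> \<le> M"
    by (rule sup_continuous_family[OF contu b1 c1]; assumption)+
  have u2: "continuous_on ({0..T} \<times> UNIV) (\<lambda>(t, x). deriv (u t) x)" "\<exists>M. \<forall>t\<in>{0..T}. \<forall>x. \<bar>deriv (u t) x\<bar> \<le> M"
    by (rule sup_continuous_family[OF uniformly_continuous_imp_continuous[OF uc] b2 c2]; assumption)+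
  obtain M1 M2 where M: "\<And>t x. t \<in> {0..T} \<Longrightarrow> \<bar>u t x\<bar> \<le> M1" "\<And>t x. t \<in> {0..T} \<Longrightarrow> \<bar>deriv (u t) x\<bar> \<le> M2"
    using u1(2) u2(2) by blast
  have decay: "(u t \<longlongrightarrow> 0) at_top" if t: "t \<in> {0..T}" for t
  proof (rule square_integrable_lipschitz_tendsto_0)
    show "square_integrable (u t)"
      using us[OF t] by (auto simp: sobolev_def has_fourier_L2_def)
    show "\<bar>u t x - u t y\<bar> \<le> M2 * \<bar>x - y\<bar>" for x y
      using field_differentiable_bound[of UNIV "u t" "deriv (u t)" M2 x y] D[OF t] M(2)[OF t] by simp
  qed
  show ?thesis
  proof (rule that[of "max M1 M2"])
    show "bounded_solution f g T (max M1 M2) u"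
      by unfold_locales (use smooth sol u1 u2 M in \<open>auto simp: le_max_iff_disj\<close>)
    show "(u t \<longlongrightarrow> 0) at_top" if "t \<in> {0..T}" for t
      by (rule decay[OF that])
    show "(deriv (u t) \<longlongrightarrow> 0) at_top" if "t \<in> {0..T}" for t
      by (rule barbalat[OF decay[OF that] D[OF that] uc[OF that]])
  qed
qed

lemma compactly_supported_bound:
  assumes "compactly_supported h"
  obtains R where "\<And>x. x \<ge> R \<Longrightarrow> h x = 0"
proof -
  obtain a where a: "\<And>x. x \<in> closure {x. h x \<noteq> 0} \<Longrightarrow> \<bar>x\<bar> \<le> a"
    using compact_imp_bounded[OF assms[unfolded compactly_supported_def]] unfolding bounded_iff by auto
  show ?thesis
  proof (rule that[of "a + 1"])
    fix x assume "x \<ge> a + 1"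
    then show "h x = 0"
      using a[of x] closure_subset[of "{x. h x \<noteq> 0}"] by auto
  qed
qed

theorem theorem2p2:
  fixes f g :: "real \<Rightarrow> real" and u :: "real \<Rightarrow> real \<Rightarrow> real" and T s :: real
  assumes "smooth f" and "smooth g"
    and "f 0 = 0" and "\<forall>x. deriv (deriv f) x \<ge> 0"
    and "\<forall>x. g x \<ge> 0" and "\<forall>x. g x = 0 \<longleftrightarrow> x = 0"
    and "deriv f 0 = 0"
    and "T > 0" and "s > 3 / 2"
    and "continuous_sobolev s T u"
    and "solves f g T u"
    and "\<exists>t\<in>{0..T}. \<exists>x. u t x \<noteq> 0"
  shows "\<not> (\<exists>t0\<in>{0..T}. \<exists>t1\<in>{0..T}. t0 \<noteq> t1 \<and>
            compactly_supported (u t0) \<and> compactly_supported (u t1))"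
proof
  assume "\<exists>t0\<in>{0..T}. \<exists>t1\<in>{0..T}. t0 \<noteq> t1 \<and> compactly_supported (u t0) \<and> compactly_supported (u t1)"
  \<comment> \<open>The assertion is symmetric in the two times, so they may be taken in
    order.\<close>
  then obtain t0 t1 where t: "t0 \<in> {0..T}" "t1 \<in> {0..T}" "t0 < t1"
    and supp: "compactly_supported (u t0)" "compactly_supported (u t1)"
    by (metis linorder_less_linear)
  obtain R0 where R0: "\<And>x. x \<ge> R0 \<Longrightarrow> u t0 x = 0"
    using compactly_supported_bound[OF supp(1)] by blast
  obtain R1 where R1: "\<And>x. x \<ge> R1 \<Longrightarrow> u t1 x = 0"
    using compactly_supported_bound[OF supp(2)] by blast
  have "g 0 = 0" using assms(6) by simp
  then obtain B where B: "bounded_solution f g T B u"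
    and decay: "\<And>t. t \<in> {0..T} \<Longrightarrow> (u t \<longlongrightarrow> 0) at_top" "\<And>t. t \<in> {0..T} \<Longrightarrow> (deriv (u t) \<longlongrightarrow> 0) at_top"
    using bounded_solutionI[OF assms(1,2) _ assms(9-11)] by blast
  interpret bounded_solution f g T B u
    by (rule B)
  have "u t0 x = 0" for x
  proof (rule compactly_supported_vanish[OF assms(3,7) _ _ _ decay t])
    show "u t0 y = 0" "u t1 y = 0" if "max R0 R1 \<le> y" for y
      using that R0 R1 by auto
  qed (use assms(4-6) in simp_all)
  then show False
    using zero_unique[OF t(1)] assms(12) by blast
qed

end
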